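(* For positive integers $k$, the numbers $shex_t(2k)$ and $stri_t(2k)$ of fixed saturated tree-like polyhexes and of fixed saturated tree-like polyiamonds of size $2k$ are given by the single expression $$shex_t(2k)=stri_t(2k)=\begin{cases}3 & \text{if } k=1,3,\\ 2 & \text{if } k=2,\\ 8 & \text{if } k=5,\\ 6 & \text{otherwise.}\end{cases}$$
   Context: The hexagonal (resp. triangular) lattice is the tiling of the plane by regular hexagons (resp. by equilateral triangles, edge to edge); two cells are adjacent iff they share an edge. A tree-like polyhex (resp. polyiamond) of size $n$ is a set of $n$ hexagonal (resp. triangular) cells whose induced adjacency graph is a tree. Fixed means considered up to translations of the lattice. $n(T)$ is the number of cells of $T$ and $n_1(T)$ is the number of leaves (cells of degree $1$). In each lattice, $L(n)$ is the maximum of $n_1(T)$ over all tree-like polyhexes (resp. polyiamonds) $T$ of size $n\ge2$; $T$ is fully leafed if $n_1(T)=L(n(T))$, and a fully leafed $T$ is saturated if $n_1(T)\ge \overline{L}(n(T))$, where $\overline{L}(n)=\frac{n+2}{2}$ in both lattices. *)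

theory Defs
  imports "HOL-Analysis.Analysis"
begin

section \<open>The hexagonal and the triangular tiling of the complex plane\<close>

text \<open>
  All tiles have side length 1. With \<open>\<omega> = cis (pi / 3)\<close>, the corners of both tilings are Eisenstein
  integers. Cells are labelled by integer coordinates; the label determines the list of corners of
  the cell in counterclockwise order.
\<close>

definition \<omega> :: complex where
  "\<omega> = cis (pi / 3)"

definition polygon_edges :: "complex list \<Rightarrow> complex set set" where
  "polygon_edges ps = (\<lambda>(p, q). closed_segment p q) ` set (zip ps (rotate1 ps))"

type_synonym hex = "int \<times> int"

text \<open>
  The centres of the hexagons form the lattice spanned by \<open>1 + \<omega>\<close> and \<open>2 * \<omega> - 1 = \<omega> + \<omega>\<^sup>2\<close>,
  two vectors of length \<open>sqrt 3\<close> at an angle of \<open>pi / 3\<close>.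
\<close>

fun hex_centre :: "hex \<Rightarrow> complex" where
  "hex_centre (a, b) = of_int a * (1 + \<omega>) + of_int b * (2 * \<omega> - 1)"

definition hex_corners :: "hex \<Rightarrow> complex list" where
  "hex_corners c = map (\<lambda>j. hex_centre c + \<omega> ^ j) [0..<6]"

definition hex_adj :: "hex \<Rightarrow> hex \<Rightarrow> bool" where
  "hex_adj c d \<longleftrightarrow> c \<noteq> d \<and> polygon_edges (hex_corners c) \<inter> polygon_edges (hex_corners d) \<noteq> {}"

fun hex_shift :: "int \<times> int \<Rightarrow> hex \<Rightarrow> hex" where
  "hex_shift (u, v) (a, b) = (a + u, b + v)"

text \<open>
  The label \<open>(a, b, up)\<close> denotes one of the two triangles forming the lattice parallelogram with
  lower left corner \<open>a + b * \<omega>\<close>: the one pointing upwards if \<open>up\<close> holds, else the other.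
\<close>

type_synonym tri = "int \<times> int \<times> bool"

fun tri_corners :: "tri \<Rightarrow> complex list" where
  "tri_corners (a, b, up) =
     map (\<lambda>z. of_int a + of_int b * \<omega> + z) (if up then [0, 1, \<omega>] else [1, 1 + \<omega>, \<omega>])"

definition tri_adj :: "tri \<Rightarrow> tri \<Rightarrow> bool" where
  "tri_adj c d \<longleftrightarrow> c \<noteq> d \<and> polygon_edges (tri_corners c) \<inter> polygon_edges (tri_corners d) \<noteq> {}"

fun tri_shift :: "int \<times> int \<Rightarrow> tri \<Rightarrow> tri" where
  "tri_shift (u, v) (a, b, up) = (a + u, b + v, up)"


section \<open>Tree-like sets of cells\<close>

definition connected_cells :: "('c \<Rightarrow> 'c \<Rightarrow> bool) \<Rightarrow> 'c set \<Rightarrow> bool" where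
  "connected_cells adj T \<longleftrightarrow>
     (\<forall>c\<in>T. \<forall>d\<in>T. (\<lambda>x y. x \<in> T \<and> y \<in> T \<and> adj x y)\<^sup>*\<^sup>* c d)"

definition has_cycle :: "('c \<Rightarrow> 'c \<Rightarrow> bool) \<Rightarrow> 'c set \<Rightarrow> bool" where
  "has_cycle adj T \<longleftrightarrow>
     (\<exists>cs. 3 \<le> length cs \<and> distinct cs \<and> set cs \<subseteq> T \<and> successively adj cs \<and> adj (last cs) (hd cs))"

definition tree_like :: "('c \<Rightarrow> 'c \<Rightarrow> bool) \<Rightarrow> 'c set \<Rightarrow> bool" where
  "tree_like adj T \<longleftrightarrow> finite T \<and> T \<noteq> {} \<and> connected_cells adj T \<and> \<not> has_cycle adj T"

definition cell_degree :: "('c \<Rightarrow> 'c \<Rightarrow> bool) \<Rightarrow> 'c set \<Rightarrow> 'c \<Rightarrow> nat" where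
  "cell_degree adj T c = card {d \<in> T. adj c d}"

definition num_leaves :: "('c \<Rightarrow> 'c \<Rightarrow> bool) \<Rightarrow> 'c set \<Rightarrow> nat" where
  "num_leaves adj T = card {c \<in> T. cell_degree adj T c = 1}"

text \<open>
  The following maximum is over a nonempty set of numbers that are at most \<open>n\<close>, since both
  lattices contain tree-like sets of every positive size. It is only used for \<open>n \<ge> 2\<close>.
\<close>

definition max_leaves :: "('c \<Rightarrow> 'c \<Rightarrow> bool) \<Rightarrow> nat \<Rightarrow> nat" where
  "max_leaves adj n = Max {num_leaves adj T | T. tree_like adj T \<and> card T = n}"

definition fully_leafed :: "('c \<Rightarrow> 'c \<Rightarrow> bool) \<Rightarrow> 'c set \<Rightarrow> bool" where
  "fully_leafed adj T \<longleftrightarrow>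
     tree_like adj T \<and> 2 \<le> card T \<and> num_leaves adj T = max_leaves adj (card T)"

definition Lbar :: "nat \<Rightarrow> real" where
  "Lbar n = (real n + 2) / 2"

definition saturated :: "('c \<Rightarrow> 'c \<Rightarrow> bool) \<Rightarrow> 'c set \<Rightarrow> bool" where
  "saturated adj T \<longleftrightarrow> fully_leafed adj T \<and> real (num_leaves adj T) \<ge> Lbar (card T)"


section \<open>Counting up to translation\<close>

definition translate_rel :: "('v \<Rightarrow> 'c \<Rightarrow> 'c) \<Rightarrow> ('c set \<times> 'c set) set" where
  "translate_rel shift = {(T, T'). \<exists>v. T' = shift v ` T}"

definition shex_t :: "nat \<Rightarrow> nat" where
  "shex_t n = card ({T. saturated hex_adj T \<and> card T = n} // translate_rel hex_shift)"

definition stri_t :: "nat \<Rightarrow> nat" where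
  "stri_t n = card ({T. saturated tri_adj T \<and> card T = n} // translate_rel tri_shift)"


section \<open>Consistency of the labelling with the geometry\<close>

lemma hex_corners_shift:
  "hex_corners (hex_shift v c) = map ((+) (hex_centre v)) (hex_corners c)"
  by (cases v; cases c) (simp add: hex_corners_def algebra_simps)

lemma tri_corners_shift:
  "tri_corners (tri_shift (u, v) c) = map ((+) (of_int u + of_int v * \<omega>)) (tri_corners c)"
  by (cases c) (simp add: algebra_simps)


lemma omega_sq: "\<omega> ^ 2 = \<omega> - 1"
  by (simp add: \<omega>_def complex_eq_iff power2_eq_square cos_60 sin_60)

lemma eisenstein_eq_iff:
  "of_int a + of_int b * \<omega> = of_int c + of_int d * \<omega> \<longleftrightarrow> a = c \<and> b = d"
proof
  assume *: "of_int a + of_int b * \<omega> = of_int c + of_int d * \<omega>"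
  from arg_cong[OF *, of Im] have "b = d"
    by (simp add: \<omega>_def sin_60)
  with * show "a = c \<and> b = d" by simp
qed auto

definition eis :: "int \<times> int \<Rightarrow> complex" where
  "eis p = of_int (fst p) + of_int (snd p) * \<omega>"

lemma eis_eq_iff [simp]: "eis p = eis q \<longleftrightarrow> p = q"
  by (simp add: eis_def eisenstein_eq_iff prod_eq_iff)

lemma closed_segment_eis_eq_iff:
  "closed_segment (eis p) (eis q) = closed_segment (eis r) (eis s) \<longleftrightarrow> {p, q} = {r, s}"
  by (auto simp: closed_segment_eq doubleton_eq_iff)

lemma polygon_edges_three:
  "polygon_edges [a, b, c] = {closed_segment a b, closed_segment b c, closed_segment c a}"
  by (simp add: polygon_edges_def)

lemma polygon_edges_six:
  "polygon_edges [a, b, c, d, e, f] =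
     {closed_segment a b, closed_segment b c, closed_segment c d,
      closed_segment d e, closed_segment e f, closed_segment f a}"
  by (simp add: polygon_edges_def)

lemma hex_corners_eis:
  "hex_corners (a, b) = map (\<lambda>(x, y). eis (a - b + x, a + 2 * b + y))
     [(1, 0), (0, 1), (-1, 1), (-1, 0), (0, -1), (1, -1)]"
proof -
  have p3: "\<omega> ^ 3 = -1"
  proof -
    have "\<omega> ^ 3 = \<omega> * \<omega> ^ 2" by (simp add: eval_nat_numeral)
    also have "\<dots> = \<omega> ^ 2 - \<omega>" unfolding omega_sq right_diff_distrib
      by (simp flip: power2_eq_square add: omega_sq)
    finally show ?thesis by (simp add: omega_sq)
  qed
  have "\<omega> ^ 4 = \<omega> ^ 3 * \<omega>" "\<omega> ^ 5 = \<omega> ^ 3 * \<omega> ^ 2"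
    by (simp_all add: eval_nat_numeral)
  then have "map (\<lambda>j. \<omega> ^ j) [0..<6] = [1, \<omega>, \<omega> - 1, -1, -\<omega>, 1 - \<omega>]"
    using p3 omega_sq by (simp add: upt_rec eval_nat_numeral)
  then have "hex_corners (a, b) = map ((+) (hex_centre (a, b))) [1, \<omega>, \<omega> - 1, -1, -\<omega>, 1 - \<omega>]"
    unfolding hex_corners_def by (metis (no_types, lifting) map_map comp_apply map_eq_conv)
  then show ?thesis
    by (simp add: eis_def algebra_simps)
qed

lemma tri_corners_eis:
  "tri_corners (a, b, up) = map (\<lambda>(x, y). eis (a + x, b + y))
     (if up then [(0, 0), (1, 0), (0, 1)] else [(1, 0), (1, 1), (0, 1)])"
  by (simp add: eis_def algebra_simps)

lemma closed_segment_eis_eqD: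
  assumes "closed_segment (eis (x, y)) (eis (x', y')) = closed_segment (eis (z, w)) (eis (z', w'))"
  shows "x + x' = z + z' \<and> y + y' = w + w'"
  using assms unfolding closed_segment_eis_eq_iff by (auto simp: doubleton_eq_iff)

lemma hex_adj_iff:
  "hex_adj (a, b) (c, d) \<longleftrightarrow>
     (c - a, d - b) \<in> {(1, 0), (0, 1), (-1, 1), (-1, 0), (0, -1), (1, -1)}"
proof
  assume adj: "hex_adj (a, b) (c, d)"
  then obtain e where e: "e \<in> polygon_edges (hex_corners (a, b))" "e \<in> polygon_edges (hex_corners (c, d))"
    unfolding hex_adj_def by blast
  from adj have ne: "\<not> (a = c \<and> b = d)"
    unfolding hex_adj_def by simp
  show "(c - a, d - b) \<in> {(1, 0), (0, 1), (-1, 1), (-1, 0), (0, -1), (1, -1)}"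
    using e ne unfolding hex_corners_eis list.map prod.case polygon_edges_six
    apply (simp only: insert_iff empty_iff simp_thms)
    apply (elim disjE; simp only:; drule closed_segment_eis_eqD; simp only: prod.inject; elim conjE)
    apply ((rule FalseE, presburger)
      | (rule disjI1, (rule conjI; linarith))
      | (rule disjI2, rule disjI1, (rule conjI; linarith))
      | (rule disjI2, rule disjI2, rule disjI1, (rule conjI; linarith))
      | (rule disjI2, rule disjI2, rule disjI2, rule disjI1, (rule conjI; linarith))
      | (rule disjI2, rule disjI2, rule disjI2, rule disjI2, rule disjI1, (rule conjI; linarith))
      | (rule disjI2, rule disjI2, rule disjI2, rule disjI2, rule disjI2, (rule conjI; linarith)))+
    done
next
  assume *: "(c - a, d - b) \<in> {(1, 0), (0, 1), (-1, 1), (-1, 0), (0, -1), (1, -1)}"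
  then consider "c = a + 1" "d = b"
    | "c = a" "d = b + 1"
    | "c = a - 1" "d = b + 1"
    | "c = a - 1" "d = b"
    | "c = a" "d = b - 1"
    | "c = a + 1" "d = b - 1"
    by (simp only: insert_iff empty_iff prod.inject) (elim disjE conjE; simp add: diff_eq_eq)
  then have "\<exists>p q. closed_segment (eis p) (eis q) \<in> polygon_edges (hex_corners (a, b)) \<and>
      closed_segment (eis p) (eis q) \<in> polygon_edges (hex_corners (c, d))"
  proof cases
    case 1
    show ?thesis
      unfolding hex_corners_eis list.map prod.case polygon_edges_six
      by (rule exI[of _ "(a - b + 1, a + 2 * b)"], rule exI[of _ "(a - b, a + 2 * b + 1)"])
        (simp add: 1 closed_segment_eis_eq_iff doubleton_eq_iff)
  next
    case 2
    show ?thesis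
      unfolding hex_corners_eis list.map prod.case polygon_edges_six
      by (rule exI[of _ "(a - b, a + 2 * b + 1)"], rule exI[of _ "(a - b - 1, a + 2 * b + 1)"])
        (simp add: 2 closed_segment_eis_eq_iff doubleton_eq_iff)
  next
    case 3
    show ?thesis
      unfolding hex_corners_eis list.map prod.case polygon_edges_six
      by (rule exI[of _ "(a - b - 1, a + 2 * b + 1)"], rule exI[of _ "(a - b - 1, a + 2 * b)"])
        (simp add: 3 closed_segment_eis_eq_iff doubleton_eq_iff)
  next
    case 4
    show ?thesis
      unfolding hex_corners_eis list.map prod.case polygon_edges_six
      by (rule exI[of _ "(a - b - 1, a + 2 * b)"], rule exI[of _ "(a - b, a + 2 * b - 1)"])
        (simp add: 4 closed_segment_eis_eq_iff doubleton_eq_iff)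
  next
    case 5
    show ?thesis
      unfolding hex_corners_eis list.map prod.case polygon_edges_six
      by (rule exI[of _ "(a - b, a + 2 * b - 1)"], rule exI[of _ "(a - b + 1, a + 2 * b - 1)"])
        (simp add: 5 closed_segment_eis_eq_iff doubleton_eq_iff)
  next
    case 6
    show ?thesis
      unfolding hex_corners_eis list.map prod.case polygon_edges_six
      by (rule exI[of _ "(a - b + 1, a + 2 * b - 1)"], rule exI[of _ "(a - b + 1, a + 2 * b)"])
        (simp add: 6 closed_segment_eis_eq_iff doubleton_eq_iff)
  qed
  moreover have "(a, b) \<noteq> (c, d)"
    using * by auto
  ultimately show "hex_adj (a, b) (c, d)"
    unfolding hex_adj_def by blast
qed

lemma tri_adj_iff:
  "tri_adj (a, b, up) (c, d, up') \<longleftrightarrow>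
     (up \<and> \<not> up' \<and> (c - a, d - b) \<in> {(0, 0), (-1, 0), (0, -1)}) \<or>
     (\<not> up \<and> up' \<and> (c - a, d - b) \<in> {(0, 0), (1, 0), (0, 1)})"
  unfolding tri_adj_def tri_corners_eis
  by (cases up; cases up')
    (simp_all add: polygon_edges_three closed_segment_eis_eq_iff doubleton_eq_iff, presburger+)

end

theory Submission
  imports Defs
begin

text \<open>
  In a finite tree with \<open>n \<ge> 2\<close> vertices, all of degree at most 3, let \<open>n\<^sub>1\<close> and \<open>n\<^sub>2\<close> be the
  numbers of vertices of degree 1 and 2. Counting edge ends gives \<open>2 * n\<^sub>1 + n\<^sub>2 = n + 2\<close>, so there
  are at most \<open>(n + 2) / 2\<close> leaves, with equality exactly when no vertex has degree 2. Tree-like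
  sets in both lattices satisfy the degree bound: a triangle has three sides, and two neighbours of
  a hexagon in consecutive directions are adjacent, so a tree-like set contains at most every other
  neighbour. Hence the saturated sets are precisely the full trees, that is, the tree-like sets of
  at least two cells in which all degrees are 1 or 3 (\<open>saturated_iff_full_tree\<close>).

  Consider triangles first. A full tree with more than two cells is the closed neighbourhood of its
  set of cells of degree 3, the inner cells. A path of four inner cells that crosses sides of all
  three directions turns around a corner of the lattice; with the neighbours of its two ends it
  covers all six triangles at that corner and so yields a cycle. Therefore a path of inner cells
  alternates between two directions of sides, which keeps it inside one strip of the lattice. The only way to branch is that an inner cell has three inner neighbours,
  and then these four cells are all the inner cells. So the inner cells form a zigzag, or a star of
  four cells (\<open>full_tree_eq_nbhd\<close>); conversely all zigzags and stars arise from full trees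
  (\<open>full_tree_zigzag\<close>, \<open>full_tree_star\<close>). A full tree of size \<open>2 * k\<close> has \<open>k - 1\<close> inner cells.
  Up to translation there are 6 zigzags with at least three cells, given by the direction of the
  strip and the orientation of the first cell, and 2 stars, given by the orientation of the centre,
  which contribute for \<open>k - 1 = 4\<close> only. A single inner cell has 2 orientations, and a pair of
  adjacent cells, which is the whole tree for \<open>k = 1\<close> and the inner part for \<open>k = 3\<close>, has 3
  directions of the common side.

  For hexagons, colour the cell \<open>(a, b)\<close> by \<open>(a - b) mod 3\<close>. The three neighbours of a cell of
  degree 3 lie in every other direction and so have the same colour; therefore a full tree only
  uses two of the three colours (\<open>two_colours_suffice\<close>). The graph induced on two colour classes is
  the adjacency graph of the triangular lattice, and the translations that respect it are those of
  that lattice (\<open>hex_full_tree_is_embedded\<close>, \<open>translate_rel_embed\<close>). So the two counts agree.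
\<close>

section \<open>Trees of cells\<close>

lemma simple_path_in:
  assumes "(\<lambda>x y. x \<in> S \<and> y \<in> S \<and> adj x y)\<^sup>*\<^sup>* a b" "b \<in> S"
  obtains ps where "ps \<noteq> []" "hd ps = a" "last ps = b" "distinct ps" "set ps \<subseteq> S" "successively adj ps"
proof -
  have "\<exists>ps. ps \<noteq> [] \<and> hd ps = a \<and> last ps = b \<and> distinct ps \<and> set ps \<subseteq> S \<and> successively adj ps"
    using assms
  proof (induction rule: converse_rtranclp_induct)
    case base
    then show ?case by (intro exI[of _ "[b]"]) auto
  next
    case (step a a')
    then obtain ps where ps: "ps \<noteq> []" "hd ps = a'" "last ps = b" "distinct ps" "set ps \<subseteq> S"
      "successively adj ps" by blast
    show ?case
    proof (cases "a \<in> set ps")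
      case True
      then obtain us vs where "ps = us @ a # vs" by (meson split_list)
      then show ?thesis
        using ps by (intro exI[of _ "a # vs"]) (auto simp: successively_append_iff)
    next
      case False
      then show ?thesis
        using ps step.hyps(1) by (intro exI[of _ "a # ps"]) (cases ps; auto)
    qed
  qed
  then show ?thesis using that by blast
qed

text \<open>
  A path from a cell of \<open>S\<close> to a cell outside has a first step that leaves \<open>S\<close>.
\<close>

lemma connected_cells_exit:
  assumes "connected_cells adj T" "S \<subseteq> T" "S \<noteq> {}" "S \<noteq> T"
  obtains x y where "x \<in> S" "y \<in> T - S" "adj x y"
proof -
  obtain a b where ab: "a \<in> S" "b \<in> T" "b \<notin> S" using assms by blast
  then have "(\<lambda>x y. x \<in> T \<and> y \<in> T \<and> adj x y)\<^sup>*\<^sup>* a b"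
    using assms unfolding connected_cells_def by blast
  then have "b \<in> S \<or> (\<exists>x\<in>S. \<exists>y\<in>T - S. adj x y)"
    by (induction rule: rtranclp_induct) (use ab in auto)
  then show ?thesis using ab that by blast
qed

locale cell_graph =
  fixes adj :: "'c \<Rightarrow> 'c \<Rightarrow> bool"
  assumes sym: "adj x y \<Longrightarrow> adj y x" and irrefl: "\<not> adj x x"
begin

text \<open>
  Two different neighbours \<open>y\<close> and \<open>z\<close> of \<open>x\<close> are joined by a simple path in \<open>S\<close>, and \<open>x\<close> would
  close it to a cycle.
\<close>

lemma unique_attachment:
  assumes "connected_cells adj S" "S \<subseteq> T" "\<not> has_cycle adj T" "x \<in> T - S"
    and "y \<in> S" "adj x y" "z \<in> S" "adj x z"
  shows "y = z"
proof (rule ccontr)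
  assume "y \<noteq> z"
  have "(\<lambda>x y. x \<in> S \<and> y \<in> S \<and> adj x y)\<^sup>*\<^sup>* y z"
    using assms unfolding connected_cells_def by blast
  then obtain ps where ps: "ps \<noteq> []" "hd ps = y" "last ps = z" "distinct ps" "set ps \<subseteq> S"
      "successively adj ps"
    using \<open>z \<in> S\<close> by (rule simple_path_in)
  have "2 \<le> length ps"
    using ps(1-3) \<open>y \<noteq> z\<close> by (cases ps) (auto simp: Suc_le_eq)
  then have "has_cycle adj T"
    unfolding has_cycle_def using ps assms(2,4,6) sym[OF assms(8)]
    by (intro exI[of _ "x # ps"]) (auto simp: successively_Cons)
  then show False using assms by simp
qed

lemma connected_cells_insert:
  assumes "connected_cells adj S" "y \<in> S" "adj x y"
  shows "connected_cells adj (insert x S)"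
proof -
  let ?R = "\<lambda>S x y. x \<in> S \<and> y \<in> S \<and> adj x y"
  have mono: "(?R (insert x S))\<^sup>*\<^sup>* c d" if "c \<in> S" "d \<in> S" for c d
  proof -
    have "(?R S)\<^sup>*\<^sup>* c d" using that assms unfolding connected_cells_def by blast
    then show ?thesis by (rule rtranclp_mono[THEN predicate2D, rotated]) auto
  qed
  have "?R (insert x S) x y" "?R (insert x S) y x" using assms sym by auto
  then have "(?R (insert x S))\<^sup>*\<^sup>* x c \<and> (?R (insert x S))\<^sup>*\<^sup>* c x" if "c \<in> S" for c
    using mono[OF that \<open>y \<in> S\<close>] mono[OF \<open>y \<in> S\<close> that]
    by (metis (mono_tags, lifting) converse_rtranclp_into_rtranclp rtranclp.rtrancl_into_rtrancl)
  then show ?thesis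
    unfolding connected_cells_def using mono by blast
qed

text \<open>
  Both directions of an edge are counted. The tree grows cell by cell from a connected part, and
  each new cell adds exactly one edge by \<open>unique_attachment\<close>.
\<close>

lemma tree_like_edge_count:
  assumes "tree_like adj T"
  shows "card {(c, d) \<in> T \<times> T. adj c d} + 2 = 2 * card T"
proof -
  have T: "finite T" "T \<noteq> {}" "connected_cells adj T" "\<not> has_cycle adj T"
    using assms by (auto simp: tree_like_def)
  have "\<exists>S\<subseteq>T. card S = Suc j \<and> connected_cells adj S \<and> card {(c, d) \<in> S \<times> S. adj c d} + 2 = 2 * card S"
    if "Suc j \<le> card T" for j
    using that
  proof (induction j)
    case 0
    obtain r where "r \<in> T" using T by blast
    then show ?case
      using irrefl by (intro exI[of _ "{r}"]) (auto simp: connected_cells_def card_eq_0_iff)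
  next
    case (Suc j)
    then obtain S where S: "S \<subseteq> T" "card S = Suc j" "connected_cells adj S"
      "card {(c, d) \<in> S \<times> S. adj c d} + 2 = 2 * card S" by auto
    have finS: "finite S" using S T finite_subset by blast
    have "S \<noteq> {}" "S \<noteq> T" using S Suc.prems by auto
    then obtain y x where xy: "y \<in> S" "x \<in> T - S" "adj y x"
      by (rule connected_cells_exit[OF T(3) S(1)])
    have only: "adj x z \<longleftrightarrow> z = y" "adj z x \<longleftrightarrow> z = y" if "z \<in> S" for z
      using unique_attachment[OF S(3) S(1) T(4) xy(2) that _ xy(1) sym[OF xy(3)]] xy(3) sym[of x z]
        sym[of z x] sym[of y x] by auto
    have "{(c, d) \<in> insert x S \<times> insert x S. adj c d} = {(x, y), (y, x)} \<union> {(c, d) \<in> S \<times> S. adj c d}"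
      using xy only irrefl by auto
    moreover have "card \<dots> = 2 + card {(c, d) \<in> S \<times> S. adj c d}"
    proof (subst card_Un_disjoint)
      show "finite {(c, d) \<in> S \<times> S. adj c d}" by (rule finite_subset[of _ "S \<times> S"]) (use finS in auto)
      show "{(x, y), (y, x)} \<inter> {(c, d) \<in> S \<times> S. adj c d} = {}" using xy by auto
      have "x \<noteq> y" using xy by auto
      then show "card {(x, y), (y, x)} + card {(c, d) \<in> S \<times> S. adj c d} = 
        2 + card {(c, d) \<in> S \<times> S. adj c d}" by simp
    qed simp
    ultimately show ?case
      using S xy finS connected_cells_insert[OF S(3) xy(1) sym[OF xy(3)]]
      by (intro exI[of _ "insert x S"]) auto
  qed
  from this[of "card T - 1"] obtain S where "S \<subseteq> T" "card S = card T"
    "card {(c, d) \<in> S \<times> S. adj c d} + 2 = 2 * card S"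
    using T by (auto simp: card_gt_0_iff Suc_leI)
  then show ?thesis using T card_subset_eq by blast
qed

lemma tree_like_degree_sum:
  assumes "tree_like adj T"
  shows "(\<Sum>c\<in>T. cell_degree adj T c) + 2 = 2 * card T"
proof -
  have "finite T" using assms by (simp add: tree_like_def)
  moreover have "{(c, d) \<in> T \<times> T. adj c d} = Sigma T (\<lambda>c. {d \<in> T. adj c d})" by auto
  ultimately show ?thesis
    using tree_like_edge_count[OF assms] by (simp add: cell_degree_def)
qed

lemma cell_degree_pos:
  assumes "tree_like adj T" "2 \<le> card T" "c \<in> T"
  shows "1 \<le> cell_degree adj T c"
proof -
  have "{c} \<noteq> T" using assms by auto
  then obtain y where "y \<in> T" "adj c y"
    using connected_cells_exit[of adj T "{c}"] assms by (auto simp: tree_like_def)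
  then have "{d \<in> T. adj c d} \<noteq> {}" by auto
  then show ?thesis
    using assms by (simp add: cell_degree_def tree_like_def Suc_le_eq card_gt_0_iff)
qed

lemma no_triangle:
  assumes "tree_like adj T" "x \<in> T" "y \<in> T" "z \<in> T" "adj x y" "adj y z"
  shows "\<not> adj x z"
proof
  assume "adj x z"
  then have "has_cycle adj T"
    using assms sym irrefl unfolding has_cycle_def
    by (intro exI[of _ "[x, y, z]"]) auto
  then show False using assms by (simp add: tree_like_def)
qed

text \<open>
  A way to recognise trees: descending ranks connect every cell to the root, and a cell of maximal
  rank on a cycle would have two neighbours on the cycle, neither of larger rank.
\<close>

lemma tree_like_by_rank:
  fixes f :: "'c \<Rightarrow> nat"
  assumes "finite T" "r \<in> T"
    and down: "\<And>x. x \<in> T \<Longrightarrow> x \<noteq> r \<Longrightarrow> \<exists>y\<in>T. adj x y \<and> f y < f x"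
    and unique: "\<And>x y z. x \<in> T \<Longrightarrow> y \<in> T \<Longrightarrow> z \<in> T \<Longrightarrow> adj x y \<Longrightarrow> adj x z \<Longrightarrow>
      f y \<le> f x \<Longrightarrow> f z \<le> f x \<Longrightarrow> y = z"
  shows "tree_like adj T"
proof -
  let ?R = "\<lambda>x y. x \<in> T \<and> y \<in> T \<and> adj x y"
  have root: "?R\<^sup>*\<^sup>* x r" if "x \<in> T" for x
    using that
  proof (induction "f x" arbitrary: x rule: less_induct)
    case less
    then show ?case
      by (cases "x = r") (use down in \<open>blast intro: converse_rtranclp_into_rtranclp\<close>)+
  qed
  have "symp ?R" using sym by (auto simp: symp_def)
  then have "?R\<^sup>*\<^sup>* r x" if "x \<in> T" for x
    using root[OF that] by (meson symp_rtranclp sympD)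
  then have "connected_cells adj T"
    unfolding connected_cells_def using root by (meson rtranclp_trans)
  moreover have False if cyc: "has_cycle adj T"
  proof -
    obtain cs where cs: "3 \<le> length cs" "distinct cs" "set cs \<subseteq> T" "successively adj cs"
      "adj (last cs) (hd cs)" using cyc unfolding has_cycle_def by blast
    define n where "n = length cs"
    have "Max (f ` set cs) \<in> f ` set cs" using cs by (intro Max_in) auto
    then obtain i where i: "i < n" "f (cs ! i) = Max (f ` set cs)"
      by (auto simp: in_set_conv_nth n_def)
    have le: "f (cs ! j) \<le> f (cs ! i)" if "j < n" for j
      using that i by (simp add: n_def)
    have step: "adj (cs ! j) (cs ! (if Suc j = n then 0 else Suc j))" if "j < n" for j
    proof (cases "Suc j = n")
      case True
      then have "cs \<noteq> []" "j = length cs - 1" by (auto simp: n_def)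
      then show ?thesis unfolding if_P[OF True] using cs(5) by (simp add: last_conv_nth hd_conv_nth)
    next
      case False
      then show ?thesis using cs that by (simp add: successively_conv_nth n_def)
    qed
    \<comment> \<open>the successor and the predecessor of position \<open>i\<close> on the cycle\<close>
    let ?j = "if Suc i = n then 0 else Suc i" and ?k = "if i = 0 then n - 1 else i - 1"
    have jk: "?j < n" "?k < n" "?j \<noteq> ?k" using i cs by (auto simp: n_def)
    have "adj (cs ! i) (cs ! ?j)" using step[OF i(1)] .
    moreover have "adj (cs ! i) (cs ! ?k)"
    proof (rule sym)
      have "(if Suc ?k = n then 0 else Suc ?k) = i" using i cs(1) by (auto simp: n_def)
      then show "adj (cs ! ?k) (cs ! i)" using step[OF jk(2)] by (simp only:)
    qed
    ultimately have "cs ! ?j = cs ! ?k"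
      using unique[of "cs ! i" "cs ! ?j" "cs ! ?k"] le jk i cs(3) n_def by (meson nth_mem subsetD)
    then show False using jk cs by (simp add: nth_eq_iff_index_eq n_def)
  qed
  ultimately show ?thesis using assms by (auto simp: tree_like_def)
qed

end

lemma has_cycle_image_iff:
  assumes "inj_on g T" "\<And>x y. x \<in> T \<Longrightarrow> y \<in> T \<Longrightarrow> adj' (g x) (g y) \<longleftrightarrow> adj x y"
  shows "has_cycle adj' (g ` T) \<longleftrightarrow> has_cycle adj T"
proof -
  have lists: "(\<exists>cs. set cs \<subseteq> g ` T \<and> P cs) \<longleftrightarrow> (\<exists>cs. set cs \<subseteq> T \<and> P (map g cs))" for P
  proof
    assume "\<exists>cs. set cs \<subseteq> g ` T \<and> P cs"
    then obtain cs where cs: "set cs \<subseteq> g ` T" "P cs" by blast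
    then have "\<forall>y\<in>set cs. \<exists>x\<in>T. y = g x" by blast
    then obtain h where "\<forall>y\<in>set cs. h y \<in> T \<and> y = g (h y)" by metis
    then show "\<exists>cs. set cs \<subseteq> T \<and> P (map g cs)"
      using cs(2) by (intro exI[of _ "map h cs"]) (auto simp: map_idI)
  next
    assume "\<exists>cs. set cs \<subseteq> T \<and> P (map g cs)"
    then show "\<exists>cs. set cs \<subseteq> g ` T \<and> P cs"
      by (metis image_mono list.set_map)
  qed
  have *: "successively adj' (map g cs) \<longleftrightarrow> successively adj cs" if "set cs \<subseteq> T" for cs
    unfolding successively_map using that assms(2) by (intro successively_cong) auto
  have "has_cycle adj' (g ` T) \<longleftrightarrow> (\<exists>cs. set cs \<subseteq> g ` T \<and> (3 \<le> length cs \<and> distinct cs \<and>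
     successively adj' cs \<and> adj' (last cs) (hd cs)))"
    unfolding has_cycle_def by blast
  also have "\<dots> \<longleftrightarrow> (\<exists>cs. set cs \<subseteq> T \<and> (3 \<le> length cs \<and> distinct cs \<and>
     successively adj cs \<and> adj (last cs) (hd cs)))"
    unfolding lists
  proof (rule ex_cong1, rule conj_cong[OF refl])
    fix cs assume cs: "set cs \<subseteq> T"
    show "(3 \<le> length (map g cs) \<and> distinct (map g cs) \<and> successively adj' (map g cs) \<and>
      adj' (last (map g cs)) (hd (map g cs))) =
      (3 \<le> length cs \<and> distinct cs \<and> successively adj cs \<and> adj (last cs) (hd cs))"
    proof (cases "3 \<le> length cs")
      case True
      then have "cs \<noteq> []" by auto
      then have "last cs \<in> T" "hd cs \<in> T" using cs by auto
      then show ?thesis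
        using * cs assms \<open>cs \<noteq> []\<close> True
        by (auto simp: last_map hd_map distinct_map intro: inj_on_subset)
    qed auto
  qed
  also have "\<dots> \<longleftrightarrow> has_cycle adj T" unfolding has_cycle_def by blast
  finally show ?thesis .
qed

lemma connected_cells_image:
  assumes "\<And>x y. x \<in> T \<Longrightarrow> y \<in> T \<Longrightarrow> adj x y \<Longrightarrow> adj' (g x) (g y)" "connected_cells adj T"
  shows "connected_cells adj' (g ` T)"
proof -
  have "(\<lambda>x y. x \<in> g ` T \<and> y \<in> g ` T \<and> adj' x y)\<^sup>*\<^sup>* (g c) (g d)"
    if "(\<lambda>x y. x \<in> T \<and> y \<in> T \<and> adj x y)\<^sup>*\<^sup>* c d" for c d
    using that
    by (induction rule: rtranclp_induct) (auto intro!: assms(1) elim!: rtranclp.rtrancl_into_rtrancl)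
  then show ?thesis using assms(2) unfolding connected_cells_def by auto
qed

lemma tree_like_image_iff:
  assumes "inj_on g T" "\<And>x y. x \<in> T \<Longrightarrow> y \<in> T \<Longrightarrow> adj' (g x) (g y) \<longleftrightarrow> adj x y"
  shows "tree_like adj' (g ` T) \<longleftrightarrow> tree_like adj T"
proof -
  let ?h = "inv_into T g"
  have "connected_cells adj' (g ` T) \<Longrightarrow> connected_cells adj (?h ` g ` T)"
    using assms by (intro connected_cells_image[of _ adj']) (auto simp: inv_into_into)
  moreover have "?h ` g ` T = T" using assms(1) by (auto simp: image_image)
  ultimately have "connected_cells adj' (g ` T) \<longleftrightarrow> connected_cells adj T"
    using connected_cells_image[of T adj adj' g] assms by auto
  then show ?thesis
    using has_cycle_image_iff[of g T adj' adj] assms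
    by (auto simp: tree_like_def finite_image_iff)
qed

lemma cell_degree_image:
  assumes "inj_on g T" "\<And>x y. x \<in> T \<Longrightarrow> y \<in> T \<Longrightarrow> adj' (g x) (g y) \<longleftrightarrow> adj x y" "c \<in> T"
  shows "cell_degree adj' (g ` T) (g c) = cell_degree adj T c"
proof -
  have "{d \<in> g ` T. adj' (g c) d} = g ` {d \<in> T. adj c d}" using assms by auto
  then show ?thesis
    using assms by (simp add: cell_degree_def card_image inj_on_subset)
qed

definition full_tree :: "('c \<Rightarrow> 'c \<Rightarrow> bool) \<Rightarrow> 'c set \<Rightarrow> bool" where
  "full_tree adj T \<longleftrightarrow>
     tree_like adj T \<and> 2 \<le> card T \<and> (\<forall>c\<in>T. cell_degree adj T c = 1 \<or> cell_degree adj T c = 3)"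

lemma full_tree_image_iff:
  assumes "inj_on g T" "\<And>x y. x \<in> T \<Longrightarrow> y \<in> T \<Longrightarrow> adj' (g x) (g y) \<longleftrightarrow> adj x y"
  shows "full_tree adj' (g ` T) \<longleftrightarrow> full_tree adj T"
  unfolding full_tree_def
  using tree_like_image_iff[of g T adj' adj] cell_degree_image[of g T adj' adj] assms
  by (auto simp: card_image)

lemma (in cell_graph) full_tree_adjacent_pair:
  assumes "full_tree adj T"
  obtains x y where "x \<in> T" "y \<in> T" "adj x y"
proof -
  have T: "tree_like adj T" "2 \<le> card T" using assms by (auto simp: full_tree_def)
  then obtain x where x: "x \<in> T" by (auto simp: tree_like_def)
  then have "1 \<le> cell_degree adj T x" using cell_degree_pos T by blast
  then have "{d \<in> T. adj x d} \<noteq> {}" unfolding cell_degree_def by (metis card.empty not_one_le_zero)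
  then show ?thesis using that x by blast
qed

locale cubic_cell_graph = cell_graph +
  assumes degree_le: "tree_like adj T \<Longrightarrow> c \<in> T \<Longrightarrow> cell_degree adj T c \<le> 3"
begin

text \<open>
  With \<open>n\<^sub>j\<close> cells of degree \<open>j\<close>, compare \<open>n\<^sub>1 + 2 * n\<^sub>2 + 3 * n\<^sub>3 = 2 * n - 2\<close>, the sum of all degrees,
  with \<open>n\<^sub>1 + n\<^sub>2 + n\<^sub>3 = n\<close>.
\<close>

lemma leaves_and_degree_two:
  assumes "tree_like adj T" "2 \<le> card T"
  shows "2 * num_leaves adj T + card {c \<in> T. cell_degree adj T c = 2} = card T + 2"
    and "num_leaves adj T = card {c \<in> T. cell_degree adj T c = 3} + 2"
proof -
  let ?d = "cell_degree adj T"
  have fin: "finite T" using assms by (simp add: tree_like_def)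
  have deg: "?d c \<in> {1, 2, 3}" if "c \<in> T" for c
    using degree_le[OF assms(1) that] cell_degree_pos[OF assms that] by auto
  have "(\<Sum>c\<in>T. ?d c) = (\<Sum>j\<in>{1, 2, 3}. \<Sum>c\<in>{c \<in> T. ?d c = j}. ?d c)"
    using deg fin by (intro sum.group[symmetric]) auto
  also have "\<dots> = (\<Sum>j\<in>{1, 2, 3}. j * card {c \<in> T. ?d c = j})"
    by (intro sum.cong) auto
  finally have 1: "(\<Sum>c\<in>T. ?d c) = (\<Sum>j\<in>{1, 2, 3}. j * card {c \<in> T. ?d c = j})" .
  have "(\<Sum>c\<in>T. 1 :: nat) = (\<Sum>j\<in>{1, 2, 3}. \<Sum>c\<in>{c \<in> T. ?d c = j}. 1)"
    using deg fin by (intro sum.group[symmetric]) auto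
  then have 2: "card T = (\<Sum>j\<in>{1, 2, 3}. card {c \<in> T. ?d c = j})" by simp
  show "2 * num_leaves adj T + card {c \<in> T. ?d c = 2} = card T + 2"
       "num_leaves adj T = card {c \<in> T. ?d c = 3} + 2"
    using 1 2 tree_like_degree_sum[OF assms(1)] by (auto simp: num_leaves_def)
qed

lemma num_leaves_full_tree:
  assumes "full_tree adj T"
  shows "2 * num_leaves adj T = card T + 2"
proof -
  have none: "{c \<in> T. cell_degree adj T c = 2} = {}" using assms by (auto simp: full_tree_def)
  show ?thesis
    using leaves_and_degree_two(1)[of T] assms unfolding none full_tree_def by simp
qed

text \<open>
  The bound \<open>2 * n\<^sub>1 \<le> n + 2\<close> is attained exactly without cells of degree 2. A set that attains it is
  fully leafed as no competitor of the same size can exceed the bound.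
\<close>

lemma saturated_iff_full_tree: "saturated adj T \<longleftrightarrow> full_tree adj T"
proof
  assume sat: "saturated adj T"
  then have T: "tree_like adj T" "2 \<le> card T" and "card T + 2 \<le> 2 * num_leaves adj T"
    by (auto simp: saturated_def fully_leafed_def Lbar_def field_simps)
  then have "card {c \<in> T. cell_degree adj T c = 2} = 0"
    using leaves_and_degree_two(1)[OF T] by simp
  then have "cell_degree adj T c \<noteq> 2" if "c \<in> T" for c
    using T that by (auto simp: tree_like_def)
  moreover have "cell_degree adj T c \<le> 3 \<and> 1 \<le> cell_degree adj T c" if "c \<in> T" for c
    using degree_le[OF T(1) that] cell_degree_pos[OF T that] by simp
  ultimately show "full_tree adj T"
    using T unfolding full_tree_def by (metis One_nat_def Suc_1 eval_nat_numeral(3) le_SucE le_antisym)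
next
  assume full: "full_tree adj T"
  then have T: "tree_like adj T" "2 \<le> card T" by (auto simp: full_tree_def)
  have "max_leaves adj (card T) = num_leaves adj T"
    unfolding max_leaves_def
  proof (rule Max_eqI)
    let ?N = "{num_leaves adj U | U. tree_like adj U \<and> card U = card T}"
    show le: "n \<le> num_leaves adj T" if n: "n \<in> ?N" for n
    proof -
      obtain U where U: "n = num_leaves adj U" "tree_like adj U" "card U = card T" using n by blast
      then have "2 * n \<le> card T + 2" using leaves_and_degree_two(1)[of U] T by simp
      then show ?thesis using num_leaves_full_tree[OF full] by simp
    qed
    show "finite ?N" by (rule finite_subset[of _ "{..num_leaves adj T}"]) (use le in auto)
  qed (use T in auto)
  then show "saturated adj T"
    using T num_leaves_full_tree[OF full]
    by (simp add: saturated_def fully_leafed_def Lbar_def field_simps flip: of_nat_add)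
qed

end


section \<open>Counting equivalence classes\<close>

lemma card_image_eq_card_image:
  assumes "\<And>a b. a \<in> A \<Longrightarrow> b \<in> A \<Longrightarrow> f a = f b \<longleftrightarrow> g a = g b"
  shows "card (f ` A) = card (g ` A)"
proof -
  let ?h = "\<lambda>y. g (inv_into A f y)"
  have h: "?h (f a) = g a" if "a \<in> A" for a
    using assms[of "inv_into A f (f a)" a] that by (simp add: inv_into_into f_inv_into_f)
  then have "?h ` f ` A = g ` A" by (force simp: image_image)
  moreover have "inj_on ?h (f ` A)"
    using h assms by (auto simp: inj_on_def)
  ultimately show ?thesis by (metis card_image)
qed

text \<open>
  The map \<open>F\<close> preserves and reflects equivalence and meets every class of \<open>B\<close>, hence it induces a
  bijection between the sets of classes.
\<close>

lemma card_quotient_eq: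
  assumes "equiv UNIV R" "equiv UNIV S"
    and "\<And>a. a \<in> A \<Longrightarrow> F a \<in> B"
    and "\<And>a a'. a \<in> A \<Longrightarrow> a' \<in> A \<Longrightarrow> (F a, F a') \<in> S \<longleftrightarrow> (a, a') \<in> R"
    and "\<And>b. b \<in> B \<Longrightarrow> \<exists>a\<in>A. (F a, b) \<in> S"
  shows "card (A // R) = card (B // S)"
proof -
  have "B // S = (\<lambda>a. S `` {F a}) ` A"
  proof
    show "B // S \<subseteq> (\<lambda>a. S `` {F a}) ` A"
    proof
      fix X assume "X \<in> B // S"
      then obtain b where b: "b \<in> B" "X = S `` {b}" by (auto simp: quotient_def)
      obtain a where "a \<in> A" "(F a, b) \<in> S" using assms(5)[OF b(1)] by blast
      then show "X \<in> (\<lambda>a. S `` {F a}) ` A" using b(2) equiv_class_eq[OF assms(2)] by blast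
    qed
    show "(\<lambda>a. S `` {F a}) ` A \<subseteq> B // S"
      using assms(3) by (auto simp: quotient_def)
  qed
  moreover have "A // R = (\<lambda>a. R `` {a}) ` A" by (auto simp: quotient_def)
  moreover have "card ((\<lambda>a. R `` {a}) ` A) = card ((\<lambda>a. S `` {F a}) ` A)"
    using assms(1,2,4) by (intro card_image_eq_card_image) (simp add: eq_equiv_class_iff)
  ultimately show ?thesis by simp
qed

lemma card_quotient_representatives:
  fixes f :: "'i \<Rightarrow> 'a"
  assumes "equiv UNIV R"
    and "\<And>i. i \<in> Rs \<Longrightarrow> f i \<in> A"
    and "\<And>i j. i \<in> Rs \<Longrightarrow> j \<in> Rs \<Longrightarrow> (f i, f j) \<in> R \<Longrightarrow> i = j"
    and "\<And>T. T \<in> A \<Longrightarrow> \<exists>i\<in>Rs. (f i, T) \<in> R"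
  shows "card (A // R) = card Rs"
proof -
  have "equiv UNIV (Id :: ('i \<times> 'i) set)" by (auto simp: equiv_def refl_on_def sym_def trans_def)
  moreover have "(f i, f j) \<in> R \<longleftrightarrow> (i, j) \<in> Id" if "i \<in> Rs" "j \<in> Rs" for i j
    using assms(3)[OF that] assms(1) by (auto simp: equiv_def refl_on_def)
  ultimately have "card (Rs // Id) = card (A // R)"
    using assms by (intro card_quotient_eq[where F = f]) auto
  moreover have "Rs // Id = (\<lambda>i. {i}) ` Rs" by (auto simp: quotient_def)
  ultimately show ?thesis by (simp add: card_image)
qed

lemma equiv_translate_rel:
  assumes "\<And>x. shift z x = x"
    and "\<And>v w. \<exists>u. \<forall>x. shift v (shift w x) = shift u x"
    and "\<And>v. \<exists>w. \<forall>x. shift w (shift v x) = x"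
  shows "equiv UNIV (translate_rel shift)"
proof (rule equivI)
  show "refl_on UNIV (translate_rel shift)"
    unfolding refl_on_def translate_rel_def using assms(1) by (auto intro!: exI[of _ z])
  show "sym (translate_rel shift)"
  proof (rule symI)
    fix S T assume "(S, T) \<in> translate_rel shift"
    then obtain v where "T = shift v ` S" by (auto simp: translate_rel_def)
    moreover obtain w where "\<forall>x. shift w (shift v x) = x" using assms(3) by blast
    ultimately have "S = shift w ` T" by (simp add: image_image)
    then show "(T, S) \<in> translate_rel shift" by (auto simp: translate_rel_def)
  qed
  show "trans (translate_rel shift)"
  proof (rule transI)
    fix S T U assume "(S, T) \<in> translate_rel shift" "(T, U) \<in> translate_rel shift"
    then obtain v w where "T = shift w ` S" "U = shift v ` T" by (auto simp: translate_rel_def)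
    moreover obtain u where "\<forall>x. shift v (shift w x) = shift u x" using assms(2) by blast
    ultimately have "U = shift u ` S" by (simp add: image_image)
    then show "(S, U) \<in> translate_rel shift" by (auto simp: translate_rel_def)
  qed
qed auto


section \<open>The triangular lattice as a brick wall\<close>

text \<open>Quantified triangles and hexagons are kept as variables instead of being split into components.\<close>

declare split_paired_All [simp del] split_paired_Ex [simp del]

text \<open>
  The sides of the triangles have three directions. The side of direction \<open>S0\<close> separates the two
  triangles of one lattice parallelogram, and \<open>S1\<close>, \<open>S2\<close> follow in the cyclic order in which the
  directions appear under rotation by a third of a turn. The function \<open>nb e\<close> crosses the side of
  direction \<open>e\<close>.
\<close>

datatype side = S0 | S1 | S2

instance side :: finite
proof
  have "UNIV = {S0, S1, S2}" using side.exhaust by blast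
  then show "finite (UNIV :: side set)" by (metis finite.simps)
qed

lemma UNIV_side: "UNIV = {S0, S1, S2}"
  using side.exhaust by blast

lemma side_exhausted: "(d :: side) \<noteq> e \<Longrightarrow> e \<noteq> f \<Longrightarrow> d \<noteq> f \<Longrightarrow> g = d \<or> g = e \<or> g = f"
  by (cases d; cases e; cases f; cases g) auto

lemma third_side: "\<exists>g :: side. g \<noteq> d \<and> g \<noteq> e"
  by (cases d; cases e) auto

fun next_side :: "side \<Rightarrow> side" where
  "next_side S0 = S1" | "next_side S1 = S2" | "next_side S2 = S0"

fun nb :: "side \<Rightarrow> tri \<Rightarrow> tri" where
  "nb S0 (a, b, u) = (a, b, \<not> u)"
| "nb S1 (a, b, u) = (if u then a - 1 else a + 1, b, \<not> u)"
| "nb S2 (a, b, u) = (a, if u then b - 1 else b + 1, \<not> u)"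

fun up :: "tri \<Rightarrow> bool" where
  "up (a, b, u) = u"

text \<open>
  For every direction \<open>d\<close> these coordinates turn the triangles into a brick wall. A row consists of
  the triangles with a fixed value of \<open>across d\<close>; it is a strip of the lattice that is left exactly
  through the sides of direction \<open>d\<close>, and \<open>along d\<close> numbers its triangles consecutively.
\<close>

fun along :: "side \<Rightarrow> tri \<Rightarrow> int" where
  "along S0 (a, b, u) = b - a"
| "along S1 (a, b, u) = - a - 2 * b - (if u then 0 else 1)"
| "along S2 (a, b, u) = 2 * a + b + (if u then 0 else 1)"

fun across :: "side \<Rightarrow> tri \<Rightarrow> int" where
  "across S0 (a, b, u) = a + b + (if u then 0 else 1)"
| "across S1 (a, b, u) = - a"
| "across S2 (a, b, u) = - b"

lemma tri_adj_iff_nb: "tri_adj x y \<longleftrightarrow> (\<exists>e. y = nb e x)"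
proof -
  have "(\<exists>e. y = nb e x) \<longleftrightarrow> y = nb S0 x \<or> y = nb S1 x \<or> y = nb S2 x"
    by (metis side.exhaust)
  then show ?thesis
    by (cases x; cases y) (auto simp: tri_adj_iff)
qed

lemma nb_nb [simp]: "nb e (nb e x) = x"
  by (cases x; cases e) auto

lemma nb_eq_iff [simp]: "nb e x = nb f x \<longleftrightarrow> e = f"
  by (cases x; cases e; cases f) auto

lemma nb_inj [simp]: "nb e x = nb e y \<longleftrightarrow> x = y"
  by (metis nb_nb)

lemma up_nb [simp]: "up (nb e x) \<longleftrightarrow> \<not> up x"
  by (cases x; cases e) auto

lemma nb_neq [simp]: "nb e x \<noteq> x" "x \<noteq> nb e x"
  by (metis up_nb)+

lemma along_nb:
  "along d (nb e x) = along d x + (if e = d then 0 else if (e = next_side d) = up x then 1 else - 1)"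
  by (cases x; cases d; cases e) auto

lemma across_nb:
  "across d (nb e x) = across d x + (if e \<noteq> d then 0 else if up x then 1 else - 1)"
  by (cases x; cases d; cases e) auto

lemma up_iff_even: "up x \<longleftrightarrow> even (along d x + across d x)"
  by (cases x; cases d) auto

lemma along_across_eqD:
  assumes "along d x = along d y" "across d x = across d y"
  shows "x = y"
proof -
  have "up x = up y" using assms by (simp add: up_iff_even[of _ d])
  then show ?thesis using assms by (cases x; cases y; cases d) auto
qed

lemma ex_along_across: "\<exists>x. along d x = g \<and> across d x = h"
proof (cases d)
  case S0
  show ?thesis
  proof (cases "even (g + h)")
    case True
    then show ?thesis using S0 by (intro exI[of _ "((h - g) div 2, (g + h) div 2, True)"]) (simp; presburger)
  next
    case False
    then show ?thesis using S0
      by (intro exI[of _ "((h - g - 1) div 2, (g + h - 1) div 2, False)"]) (simp; presburger)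
  qed
next
  case S1
  show ?thesis
  proof (cases "even (g + h)")
    case True
    then show ?thesis using S1 by (intro exI[of _ "(- h, (h - g) div 2, True)"]) (simp; presburger)
  next
    case False
    then show ?thesis using S1
      by (intro exI[of _ "(- h, (h - g - 1) div 2, False)"]) (simp; presburger)
  qed
next
  case S2
  show ?thesis
  proof (cases "even (g + h)")
    case True
    then show ?thesis using S2 by (intro exI[of _ "((g + h) div 2, - h, True)"]) auto
  next
    case False
    then show ?thesis using S2
      by (intro exI[of _ "((g + h - 1) div 2, - h, False)"]) (simp; presburger)
  qed
qed

interpretation tri: cell_graph tri_adj
proof
  show "tri_adj y x" if "tri_adj x y" for x y
    using that by (metis tri_adj_iff_nb nb_nb)
qed (simp add: tri_adj_iff_nb)

lemma cell_degree_tri: "cell_degree tri_adj T x = card {e. nb e x \<in> T}"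
proof -
  have "{d \<in> T. tri_adj x d} = (\<lambda>e. nb e x) ` {e. nb e x \<in> T}"
    by (auto simp: tri_adj_iff_nb)
  then show ?thesis by (simp add: cell_degree_def card_image inj_on_def)
qed

lemma cell_degree_tri_eq_3_iff: "cell_degree tri_adj T x = 3 \<longleftrightarrow> (\<forall>e. nb e x \<in> T)"
proof -
  have 3: "card (UNIV :: side set) = 3" by (simp add: UNIV_side)
  then have "card {e. nb e x \<in> T} = 3 \<longleftrightarrow> {e. nb e x \<in> T} = UNIV"
    by (metis card_subset_eq finite subset_UNIV)
  then show ?thesis by (auto simp: cell_degree_tri)
qed

interpretation tri: cubic_cell_graph tri_adj
proof
  fix T c
  have "card {e. nb e c \<in> T} \<le> card (UNIV :: side set)" by (rule card_mono) auto
  then show "cell_degree tri_adj T c \<le> 3" by (simp add: cell_degree_tri UNIV_side)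
qed


section \<open>Closed neighbourhoods of zigzags and stars\<close>

definition nbhd :: "tri set \<Rightarrow> tri set" where
  "nbhd I = I \<union> {x. \<exists>e. nb e x \<in> I}"

lemma mem_nbhd: "x \<in> nbhd I \<longleftrightarrow> x \<in> I \<or> (\<exists>e. nb e x \<in> I)"
  by (simp add: nbhd_def)

lemma nb_in_nbhd: "x \<in> I \<Longrightarrow> nb e x \<in> nbhd I"
  unfolding mem_nbhd by (metis nb_nb)

lemma nbhd_insert: "nbhd (insert x I) = nbhd I \<union> insert x (range (\<lambda>e. nb e x))"
proof -
  have "nb e y = x \<longleftrightarrow> y = nb e x" for e y by (metis nb_nb)
  then show ?thesis by (auto simp: nbhd_def)
qed

lemma finite_nbhd: "finite I \<Longrightarrow> finite (nbhd I)"
proof -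
  assume "finite I"
  moreover have "nbhd I = I \<union> (\<Union>e. nb e ` I)"
    unfolding nbhd_def by (auto simp: image_iff) (metis nb_nb)+
  ultimately show ?thesis by simp
qed

text \<open>
  The rank \<open>f\<close> makes \<open>I\<close> a tree rooted at \<open>r\<close>, and the assumption \<open>leaf\<close> says that every further
  cell of the closed neighbourhood has a single neighbour there. So these cells are leaves, while the
  cells of \<open>I\<close> keep all three neighbours. The cardinality follows since a full tree has two more
  leaves than cells of degree 3.
\<close>

lemma full_tree_nbhd:
  fixes f :: "tri \<Rightarrow> nat"
  assumes fin: "finite I" and r: "r \<in> I"
    and leaf: "\<And>x e e'. x \<notin> I \<Longrightarrow> nb e x \<in> I \<Longrightarrow> nb e' x \<in> nbhd I \<Longrightarrow> e = e'"
    and down: "\<And>x. x \<in> I \<Longrightarrow> x \<noteq> r \<Longrightarrow> \<exists>e. nb e x \<in> I \<and> f (nb e x) < f x"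
    and unique: "\<And>x e e'. x \<in> I \<Longrightarrow> nb e x \<in> I \<Longrightarrow> nb e' x \<in> I \<Longrightarrow>
      f (nb e x) \<le> f x \<Longrightarrow> f (nb e' x) \<le> f x \<Longrightarrow> e = e'"
  shows "full_tree tri_adj (nbhd I)" and "card (nbhd I) = 2 * card I + 2"
    and "{x \<in> nbhd I. cell_degree tri_adj (nbhd I) x = 3} = I"
proof -
  \<comment> \<open>the rank of a further cell is one more than that of its neighbour in \<open>I\<close>\<close>
  define F where "F x = (if x \<in> I then f x else Suc (f (nb (SOME e. nb e x \<in> I) x)))" for x
  have F_leaf: "F x = Suc (f (nb e x))" if "x \<notin> I" "nb e x \<in> I" for x e
  proof -
    have "nb (SOME e. nb e x \<in> I) x \<in> I" using that(2) by (rule someI)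
    then have "(SOME e. nb e x \<in> I) = e"
      using leaf that by (metis mem_nbhd)
    then show ?thesis using that by (simp add: F_def)
  qed
  have F_leaf': "F (nb e x) = Suc (f x)" if "nb e x \<notin> I" "x \<in> I" for x e
    using F_leaf[of "nb e x" e] that by simp
  have F_inner: "F x = f x" if "x \<in> I" for x using that by (simp add: F_def)
  have tree: "tree_like tri_adj (nbhd I)"
  proof (rule tri.tree_like_by_rank[where f = F and r = r])
    show "finite (nbhd I)" "r \<in> nbhd I" using fin r by (auto simp: finite_nbhd mem_nbhd)
  next
    fix x assume x: "x \<in> nbhd I" "x \<noteq> r"
    show "\<exists>y\<in>nbhd I. tri_adj x y \<and> F y < F x"
    proof (cases "x \<in> I")
      case True
      then obtain e where "nb e x \<in> I" "f (nb e x) < f x" using down[OF True x(2)] by blast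
      then show ?thesis
        using True F_inner by (intro bexI[of _ "nb e x"]) (auto simp: tri_adj_iff_nb mem_nbhd)
    next
      case False
      then obtain e where e: "nb e x \<in> I" using x by (auto simp: mem_nbhd)
      then have "F (nb e x) < F x" using F_leaf[OF False e] F_inner by simp
      then show ?thesis using e by (auto simp: tri_adj_iff_nb mem_nbhd)
    qed
  next
    fix x y z assume "x \<in> nbhd I" "y \<in> nbhd I" "z \<in> nbhd I" "tri_adj x y" "tri_adj x z"
      and le: "F y \<le> F x" "F z \<le> F x"
    then obtain e e' where e: "y = nb e x" "z = nb e' x" by (auto simp: tri_adj_iff_nb)
    show "y = z"
    proof (cases "x \<in> I")
      case True
      have "y \<in> I" "z \<in> I" using F_leaf' F_inner True e le by fastforce+
      then show ?thesis using unique[OF True, of e e'] le F_inner True e by simp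
    next
      case False
      then obtain e0 where "nb e0 x \<in> I" using \<open>x \<in> nbhd I\<close> by (auto simp: mem_nbhd)
      then show ?thesis
        using leaf[OF False, of e0] e \<open>y \<in> nbhd I\<close> \<open>z \<in> nbhd I\<close> by metis
    qed
  qed
  have inner: "cell_degree tri_adj (nbhd I) x = 3" if "x \<in> I" for x
    using that by (simp add: cell_degree_tri_eq_3_iff nb_in_nbhd)
  have outer: "cell_degree tri_adj (nbhd I) x = 1" if x: "x \<in> nbhd I" "x \<notin> I" for x
  proof -
    obtain e where e: "nb e x \<in> I" using x unfolding mem_nbhd by blast
    then have "{e. nb e x \<in> nbhd I} = {e}"
      using leaf[OF x(2) e] by (auto simp: mem_nbhd)
    then show ?thesis by (simp add: cell_degree_tri)
  qed
  show inner_eq: "{x \<in> nbhd I. cell_degree tri_adj (nbhd I) x = 3} = I"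
  proof (intro equalityI subsetI)
    fix x assume "x \<in> {x \<in> nbhd I. cell_degree tri_adj (nbhd I) x = 3}"
    then show "x \<in> I" using outer[of x] by auto
  next
    fix x assume "x \<in> I"
    then show "x \<in> {x \<in> nbhd I. cell_degree tri_adj (nbhd I) x = 3}"
      using inner[of x] by (simp add: mem_nbhd)
  qed
  have "{r, nb S0 r} \<subseteq> nbhd I" using r nb_in_nbhd[OF r] by (simp add: mem_nbhd)
  then have "card {r, nb S0 r} \<le> card (nbhd I)" using finite_nbhd[OF fin] card_mono by blast
  then have "2 \<le> card (nbhd I)" by simp
  then show full: "full_tree tri_adj (nbhd I)"
    unfolding full_tree_def using tree inner outer by metis
  show "card (nbhd I) = 2 * card I + 2"
    using tri.num_leaves_full_tree[OF full] tri.leaves_and_degree_two(2)[OF tree]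
      \<open>2 \<le> card (nbhd I)\<close> inner_eq by simp
qed

definition zigzag :: "side \<Rightarrow> int \<Rightarrow> int \<Rightarrow> nat \<Rightarrow> tri set" where
  "zigzag d h s m = {x. across d x = h \<and> s \<le> along d x \<and> along d x < s + int m}"

lemma bij_betw_along_zigzag: "bij_betw (along d) (zigzag d h s m) {s..<s + int m}"
proof (rule bij_betw_imageI)
  show "inj_on (along d) (zigzag d h s m)"
    by (rule inj_onI, rule along_across_eqD[of d]) (simp_all add: zigzag_def)
  show "along d ` zigzag d h s m = {s..<s + int m}"
  proof (intro equalityI subsetI)
    fix g assume "g \<in> {s..<s + int m}"
    moreover obtain x where "along d x = g" "across d x = h" using ex_along_across by blast
    ultimately show "g \<in> along d ` zigzag d h s m" by (intro image_eqI[of _ _ x]) (auto simp: zigzag_def)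
  qed (auto simp: zigzag_def)
qed

lemma finite_zigzag: "finite (zigzag d h s m)"
  and card_zigzag: "card (zigzag d h s m) = m"
  using bij_betw_finite[OF bij_betw_along_zigzag] bij_betw_same_card[OF bij_betw_along_zigzag, of d h s m]
  by auto

text \<open>
  The zigzag is a path, ranked by the position in its row. A neighbour outside of it either
  continues the row or lies in an adjacent row; in the adjacent rows the neighbours of the zigzag
  take every other position and none beyond its ends, so they are adjacent to the zigzag only.
\<close>

lemma full_tree_zigzag:
  assumes "m \<ge> 1"
  shows "full_tree tri_adj (nbhd (zigzag d h s m))"
    and "card (nbhd (zigzag d h s m)) = 2 * m + 2"
    and "{x \<in> nbhd (zigzag d h s m). cell_degree tri_adj (nbhd (zigzag d h s m)) x = 3} = zigzag d h s m"
proof -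
  let ?I = "zigzag d h s m"
  obtain r where r: "along d r = s" "across d r = h" using ex_along_across by blast
  have leaf: "e = e'" if x: "x \<notin> ?I" "nb e x \<in> ?I" "nb e' x \<in> nbhd ?I" for x e e'
  proof (rule ccontr)
    assume "e \<noteq> e'"
    have I: "across d y = h" "s \<le> along d y" "along d y < s + int m" if "y \<in> ?I" for y
      using that by (simp_all add: zigzag_def)
    \<comment> \<open>the two directions other than \<open>d\<close> lead to opposite ends of the row\<close>
    have turn: "(a = next_side d) \<noteq> (b = next_side d)" if "a \<noteq> b" "a \<noteq> d" "b \<noteq> d" for a b
      using that by (cases d; cases a; cases b) auto
    consider "nb e' x \<in> ?I" | g where "g \<noteq> e'" "nb g (nb e' x) \<in> ?I"
      using x(1,3) unfolding mem_nbhd by (metis nb_nb)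
    then show False
    proof cases
      case 1
      show False
      proof (cases "e = d \<or> e' = d")
        case True
        then show False using I(1)[OF x(2)] I(1)[OF 1] \<open>e \<noteq> e'\<close>
          by (auto simp: across_nb split: if_splits)
      next
        case False
        then have "x \<in> ?I"
          using I[OF x(2)] I[OF 1] turn[OF \<open>e \<noteq> e'\<close>]
          by (auto simp: zigzag_def across_nb along_nb split: if_splits)
        then show False using x(1) by blast
      qed
    next
      case (2 g)
      show False
      proof (cases "e = d")
        case True
        then show False using I(1)[OF x(2)] I(1)[OF 2(2)] \<open>e \<noteq> e'\<close>
          by (auto simp: across_nb split: if_splits)
      next
        case False
        then have "e' \<noteq> d" "g \<noteq> d"
          using I(1)[OF x(2)] I(1)[OF 2(2)] 2(1) by (auto simp: across_nb split: if_splits)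
        then have "x \<in> ?I"
          using I[OF x(2)] I[OF 2(2)] turn[OF \<open>e \<noteq> e'\<close>] turn[OF \<open>g \<noteq> e'\<close>] False
          by (auto simp: zigzag_def across_nb along_nb split: if_splits)
        then show False using x(1) by blast
      qed
    qed
  qed
  let ?f = "\<lambda>x. nat (along d x - s)"
  have down: "\<exists>e. nb e x \<in> ?I \<and> ?f (nb e x) < ?f x" if x: "x \<in> ?I" "x \<noteq> r" for x
  proof -
    have "along d x > s" using x r along_across_eqD[of d x r] by (fastforce simp: zigzag_def)
    then show ?thesis
      using x(1)
      by (intro exI[of _ "if up x then next_side (next_side d) else next_side d"])
        (cases d; cases "up x"; simp add: zigzag_def along_nb across_nb)
  qed
  have unique: "e = e'" if "x \<in> ?I" "nb e x \<in> ?I" "nb e' x \<in> ?I"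
      "?f (nb e x) \<le> ?f x" "?f (nb e' x) \<le> ?f x" for x e e'
  proof -
    have "e \<noteq> d" "e' \<noteq> d" using that(1-3) by (auto simp: zigzag_def across_nb split: if_splits)
    moreover have "along d (nb e x) \<le> along d x" "along d (nb e' x) \<le> along d x"
      using that by (auto simp: zigzag_def)
    ultimately have "(e = next_side d) = (e' = next_side d)"
      by (auto simp: along_nb split: if_splits)
    then show ?thesis using \<open>e \<noteq> d\<close> \<open>e' \<noteq> d\<close> by (cases d; cases e; cases e') auto
  qed
  have "r \<in> ?I" using r assms by (simp add: zigzag_def)
  note * = full_tree_nbhd[where f = ?f, OF finite_zigzag this leaf down unique]
  show "full_tree tri_adj (nbhd ?I)" "card (nbhd ?I) = 2 * m + 2"
     "{x \<in> nbhd ?I. cell_degree tri_adj (nbhd ?I) x = 3} = ?I"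
    using * card_zigzag by auto
qed

lemma nbhd_singleton: "nbhd {c} = {c, nb S0 c, nb S1 c, nb S2 c}"
  using nbhd_insert[of c "{}"] by (auto simp: nbhd_def UNIV_side)

lemma card_nbhd_singleton: "card (nbhd {c}) = 4"
  by (simp add: nbhd_singleton)

lemma in_nbhd_singleton: "x \<in> nbhd {c} \<longleftrightarrow> x = c \<or> (\<exists>e. x = nb e c)"
  unfolding mem_nbhd by (metis nb_nb singletonD singletonI)

text \<open>
  A cell at distance two from the centre \<open>c\<close> has the form \<open>nb e (nb p c)\<close> with \<open>e \<noteq> p\<close>. Since
  orientations alternate, a second neighbour of it in the closed neighbourhood would have to be some
  \<open>nb q c\<close>. With \<open>c\<close> and \<open>nb p c\<close> this would give a cycle of length 4, but the lattice has none.
\<close>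

lemma full_tree_star:
  shows "full_tree tri_adj (nbhd (nbhd {c}))"
    and "card (nbhd (nbhd {c})) = 10"
    and "{x \<in> nbhd (nbhd {c}). cell_degree tri_adj (nbhd (nbhd {c})) x = 3} = nbhd {c}"
proof -
  let ?I = "nbhd {c}"
  have leaf: "e = e'" if x: "x \<notin> ?I" "nb e x \<in> ?I" "nb e' x \<in> nbhd ?I" for x e e'
  proof -
    obtain p where p: "nb e x = nb p c" using x by (metis in_nbhd_singleton nb_nb)
    then have x_eq: "x = nb e (nb p c)" by (metis nb_nb)
    then have "e \<noteq> p" using x by (auto simp: in_nbhd_singleton)
    have "nb e' x = c \<or> (\<exists>q. nb e' x = nb q c) \<or> (\<exists>q r. nb e' x = nb r (nb q c))"
      using x(3) unfolding mem_nbhd[of _ ?I] in_nbhd_singleton by (metis nb_nb)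
    moreover have "up (nb e' x) \<noteq> up c" by (simp add: x_eq)
    ultimately obtain q where "nb e' x = nb q c" by (metis up_nb)
    then have "nb e' (nb e (nb p c)) = nb q c" by (simp add: x_eq)
    then show "e = e'" using \<open>e \<noteq> p\<close>
      by (cases c; cases e; cases e'; cases p; cases q) (auto split: if_splits)
  qed
  let ?f = "\<lambda>x. if x = c then 0 else 1 :: nat"
  have down: "\<exists>e. nb e x \<in> ?I \<and> ?f (nb e x) < ?f x" if x: "x \<in> ?I" "x \<noteq> c" for x
  proof -
    obtain p where "x = nb p c" using x by (auto simp: in_nbhd_singleton)
    then show ?thesis using x(2) by (intro exI[of _ p]) (simp add: in_nbhd_singleton)
  qed
  have unique: "e = e'" if x: "x \<in> ?I" "nb e x \<in> ?I" "nb e' x \<in> ?I"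
      "?f (nb e x) \<le> ?f x" "?f (nb e' x) \<le> ?f x" for x e e'
  proof (cases "x = c")
    case True
    then show ?thesis using x by simp
  next
    case False
    then obtain p where p: "x = nb p c" using x(1) by (auto simp: in_nbhd_singleton)
    have "nb g x = c" if "nb g x \<in> ?I" for g
      using that p unfolding in_nbhd_singleton by (metis up_nb)
    then show ?thesis using x(2,3) by (metis nb_eq_iff)
  qed
  have "c \<in> ?I" by (simp add: in_nbhd_singleton)
  note * = full_tree_nbhd[where f = ?f, OF finite_nbhd this leaf down unique]
  show "full_tree tri_adj (nbhd ?I)" "card (nbhd ?I) = 10"
     "{x \<in> nbhd ?I. cell_degree tri_adj (nbhd ?I) x = 3} = ?I"
    using * card_nbhd_singleton by auto
qed

text \<open>
  Crossing sides of the three directions in turn goes around a corner of the lattice, and six such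
  steps return to the start. Four consecutive triangles at a corner in \<open>I\<close> put the other two into the
  closed neighbourhood.
\<close>

lemma has_cycle_hexagon:
  assumes "d \<noteq> e" "e \<noteq> f" "d \<noteq> f"
    and "{x, nb d x, nb e (nb d x), nb f (nb e (nb d x))} \<subseteq> I" and "nbhd I \<subseteq> T"
  shows "has_cycle tri_adj T"
proof -
  let ?x1 = "nb d x" and ?x2 = "nb e (nb d x)" and ?x3 = "nb f (nb e (nb d x))"
  let ?x4 = "nb d ?x3" and ?x5 = "nb f x"
  have adj: "tri_adj y (nb g y)" "tri_adj (nb g y) y" for y g
    unfolding tri_adj_iff_nb by (blast, metis nb_nb)
  have "?x5 = nb e ?x4"
    using assms(1-3) by (cases x; cases d; cases e; cases f) auto
  then have "tri_adj ?x4 ?x5" using adj by metis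
  moreover have "distinct [x, ?x1, ?x2, ?x3, ?x4, ?x5]"
    using assms(1-3) by (cases x; cases d; cases e; cases f) auto
  moreover have "set [x, ?x1, ?x2, ?x3, ?x4, ?x5] \<subseteq> T"
  proof -
    have "?x4 \<in> nbhd I" "?x5 \<in> nbhd I" using assms(4) by (simp_all add: nb_in_nbhd)
    then show ?thesis using assms(4,5) unfolding list.set nbhd_def by blast
  qed
  ultimately show ?thesis
    unfolding has_cycle_def
    by (intro exI[of _ "[x, ?x1, ?x2, ?x3, ?x4, ?x5]"] conjI) (simp_all add: adj)
qed


section \<open>Classification of the full trees of triangles\<close>

definition inner_shape :: "tri set \<Rightarrow> bool" where
  "inner_shape I \<longleftrightarrow> (\<exists>d h s m. 1 \<le> m \<and> I = zigzag d h s m) \<or> (\<exists>c. I = nbhd {c})"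

lemma zigzag_1: "{c} = zigzag d (across d c) (along d c) 1"
proof
  show "zigzag d (across d c) (along d c) 1 \<subseteq> {c}"
    using along_across_eqD[of d _ c] by (simp add: zigzag_def subset_iff)
qed (simp add: zigzag_def)

text \<open>
  A pair of adjacent cells is a zigzag in either of the two directions of strips that contain it.
  This, and likewise the fact that every path of three cells is a zigzag, lets a short zigzag be
  extended sideways.
\<close>

lemma zigzag_2:
  assumes "e \<noteq> d"
  shows "{c, nb e c} = zigzag d (across d c) (min (along d c) (along d (nb e c))) 2"
proof
  show "zigzag d (across d c) (min (along d c) (along d (nb e c))) 2 \<subseteq> {c, nb e c}"
  proof
    fix x assume x: "x \<in> zigzag d (across d c) (min (along d c) (along d (nb e c))) 2"
    then have "along d x = along d c \<or> along d x = along d (nb e c)"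
      using assms by (auto simp: zigzag_def along_nb split: if_splits)
    moreover have "across d x = across d c" "across d x = across d (nb e c)"
      using x assms by (auto simp: zigzag_def across_nb)
    ultimately show "x \<in> {c, nb e c}" using along_across_eqD by blast
  qed
qed (use assms in \<open>auto simp: zigzag_def along_nb across_nb\<close>)

lemma zigzag_3:
  assumes "e \<noteq> d" "f \<noteq> d" "e \<noteq> f"
  shows "{nb e c, c, nb f c} = zigzag d (across d c) (along d c - 1) 3"
proof
  have ef: "(e = next_side d) \<noteq> (f = next_side d)"
    using assms by (cases d; cases e; cases f) auto
  show "zigzag d (across d c) (along d c - 1) 3 \<subseteq> {nb e c, c, nb f c}"
  proof
    fix x assume x: "x \<in> zigzag d (across d c) (along d c - 1) 3"
    then have "along d x = along d c \<or> along d x = along d (nb e c) \<or> along d x = along d (nb f c)"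
      using assms ef by (auto simp: zigzag_def along_nb)
    moreover have "across d x = across d c" "across d x = across d (nb e c)" "across d x = across d (nb f c)"
      using x assms by (auto simp: zigzag_def across_nb)
    ultimately show "x \<in> {nb e c, c, nb f c}" using along_across_eqD by blast
  qed
  show "{nb e c, c, nb f c} \<subseteq> zigzag d (across d c) (along d c - 1) 3"
    using assms by (auto simp: zigzag_def along_nb across_nb)
qed

text \<open>
  The new cell \<open>nb e y\<close> may prolong the row of a zigzag. Otherwise it lies beside the row, and if the
  row extends at least two steps from \<open>y\<close> to one side, then \<open>has_cycle_hexagon\<close> applies. This leaves
  zigzags of at most three cells with \<open>y\<close> in the middle of three: one or two cells become a zigzag of
  another direction, and three cells become a star. Stars have no extension for the same reason.
\<close>

lemma inner_shape_extend:
  assumes "inner_shape I" "y \<in> I" "nb e y \<notin> I"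
    and "nbhd (insert (nb e y) I) \<subseteq> T" "\<not> has_cycle tri_adj T"
  shows "inner_shape (insert (nb e y) I)"
proof -
  let ?x = "nb e y"
  \<comment> \<open>with \<open>?x\<close> and \<open>y\<close>, these would be four triangles at one corner\<close>
  have no_hexagon: False
    if "f \<noteq> e" "g \<noteq> e" "f \<noteq> g" "nb f y \<in> I" "nb g (nb f y) \<in> I" for f g
    using has_cycle_hexagon[of e f g ?x "insert ?x I" T] that assms(2,4,5) by auto
  from assms(1) consider d h s m where "1 \<le> m" "I = zigzag d h s m" | c where "I = nbhd {c}"
    unfolding inner_shape_def by blast
  then show ?thesis
  proof cases
    case (1 d h s m)
    have y: "across d y = h" "s \<le> along d y" "along d y < s + int m"
      using assms(2) 1 by (auto simp: zigzag_def)
    show ?thesis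
    proof (cases "e = d")
      case False
      then have h: "across d ?x = h" using y by (simp add: across_nb)
      have "along d ?x = along d y + 1 \<or> along d ?x = along d y - 1"
        using False by (simp add: along_nb)
      moreover have "\<not> (s \<le> along d ?x \<and> along d ?x < s + int m)"
        using assms(3) h 1(2) by (simp add: zigzag_def)
      ultimately consider "along d ?x = s - 1" | "along d ?x = s + int m"
        using y by linarith
      then have "insert ?x I = zigzag d h (s - 1) (Suc m) \<or> insert ?x I = zigzag d h s (Suc m)"
      proof cases
        case a: 1
        have "insert ?x I = zigzag d h (s - 1) (Suc m)"
          unfolding 1(2) using a h along_across_eqD[of d _ ?x] by (fastforce simp: zigzag_def)
        then show ?thesis ..
      next
        case a: 2
        have "insert ?x I = zigzag d h s (Suc m)"
          unfolding 1(2) using a h along_across_eqD[of d _ ?x] by (fastforce simp: zigzag_def)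
        then show ?thesis ..
      qed
      then show ?thesis unfolding inner_shape_def by (metis le_add1 plus_1_eq_Suc)
    next
      case True
      \<comment> \<open>from \<open>y\<close>, side \<open>p\<close> leads one step up the row and side \<open>q\<close> one step down\<close>
      define p where "p = (if up y then next_side d else next_side (next_side d))"
      define q where "q = (if up y then next_side (next_side d) else next_side d)"
      have pq: "p \<noteq> d" "q \<noteq> d" "p \<noteq> q" by (cases d; simp add: p_def q_def)+
      have steps: "along d (nb p y) = along d y + 1" "along d (nb q (nb p y)) = along d y + 2"
        "along d (nb q y) = along d y - 1" "along d (nb p (nb q y)) = along d y - 2"
        by (cases d; simp add: p_def q_def along_nb)+
      have row: "across d (nb p y) = h" "across d (nb q (nb p y)) = h"
        "across d (nb q y) = h" "across d (nb p (nb q y)) = h"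
        using pq y by (simp_all add: across_nb)
      have "\<not> along d y + 2 < s + int m"
        using no_hexagon[of p q] pq True steps row y by (auto simp: 1(2) zigzag_def)
      moreover have "\<not> s \<le> along d y - 2"
        using no_hexagon[of q p] pq True steps row y by (auto simp: 1(2) zigzag_def)
      ultimately consider "m = 1" "along d y = s" | "m = 2" "along d y = s"
        | "m = 2" "along d y = s + 1" | "m = 3" "along d y = s + 1"
        using y 1(1) by linarith
      then show ?thesis
      proof cases
        case a: 1
        then have "I = {y}" using zigzag_1[of y d] y 1 by simp
        then have "insert ?x I = {y, nb d y}" using True by auto
        also have "\<dots> = zigzag p (across p y) (min (along p y) (along p (nb d y))) 2"
          using zigzag_2 pq by metis
        finally show ?thesis unfolding inner_shape_def by (metis one_le_numeral)
      next
        case a: 2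
        then have "I = {y, nb p y}" using zigzag_2[OF pq(1), of y] y 1 steps by simp
        then have "insert ?x I = {nb p y, y, nb d y}" using True by auto
        also have "\<dots> = zigzag q (across q y) (along q y - 1) 3"
          using zigzag_3 pq by metis
        finally show ?thesis unfolding inner_shape_def by (metis one_le_numeral)
      next
        case a: 3
        then have "I = {y, nb q y}" using zigzag_2[OF pq(2), of y] y 1 steps by simp
        then have "insert ?x I = {nb q y, y, nb d y}" using True by auto
        also have "\<dots> = zigzag p (across p y) (along p y - 1) 3"
          using zigzag_3 pq by metis
        finally show ?thesis unfolding inner_shape_def by (metis one_le_numeral)
      next
        case a: 4
        then have "I = {nb p y, y, nb q y}" using zigzag_3[OF pq, of y] y 1 by simp
        moreover have "z \<in> nbhd {y} \<longleftrightarrow> z = y \<or> z = nb d y \<or> z = nb p y \<or> z = nb q y" for z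
          unfolding in_nbhd_singleton using side_exhausted[of d p q] pq by metis
        ultimately have "insert ?x I = nbhd {y}" using True by blast
        then show ?thesis unfolding inner_shape_def by blast
      qed
    qed
  next
    case (2 c)
    then obtain p where p: "y = nb p c"
      using assms(2,3) by (auto simp: in_nbhd_singleton)
    then have "p \<noteq> e" using assms(3) 2 by (auto simp: in_nbhd_singleton)
    moreover obtain g where "g \<noteq> p" "g \<noteq> e" using third_side by blast
    ultimately show ?thesis
      using no_hexagon[of p g] p 2 by (auto simp: in_nbhd_singleton)
  qed
qed

text \<open>
  Among the inner shapes whose closed neighbourhood lies in the tree choose a largest one. If it
  does not give the whole tree, some leaf of the closed neighbourhood has another neighbour in the
  tree, hence has degree 3 there and can be added to the shape by \<open>inner_shape_extend\<close>.
\<close>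

lemma full_tree_eq_nbhd:
  assumes full: "full_tree tri_adj T" and "card T \<noteq> 2"
  obtains I where "inner_shape I" "T = nbhd I"
proof -
  have tree: "tree_like tri_adj T" and "finite T" "connected_cells tri_adj T" "\<not> has_cycle tri_adj T"
    using full by (auto simp: full_tree_def tree_like_def)
  have deg: "cell_degree tri_adj T c = 1 \<or> (\<forall>e. nb e c \<in> T)" if "c \<in> T" for c
    using full that by (auto simp: full_tree_def simp flip: cell_degree_tri_eq_3_iff)
  let ?P = "\<lambda>I. inner_shape I \<and> nbhd I \<subseteq> T"
  have "\<exists>c\<in>T. \<forall>e. nb e c \<in> T"
  proof (rule ccontr)
    assume "\<not> ?thesis"
    then have "{c \<in> T. cell_degree tri_adj T c = 1} = T" using deg by blast
    then show False using tri.num_leaves_full_tree[OF full] assms(2) by (simp add: num_leaves_def)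
  qed
  then obtain c where "c \<in> T" "\<forall>e. nb e c \<in> T" by blast
  moreover have "inner_shape {c}"
    unfolding inner_shape_def using zigzag_1[of c S0] by (metis le_refl)
  ultimately have "?P {c}"
    by (auto simp: in_nbhd_singleton)
  moreover have "card I < Suc (card T)" if "?P I" for I
    using that \<open>finite T\<close> by (meson card_mono le_imp_less_Suc mem_nbhd subset_iff)
  ultimately obtain I where I: "?P I" and max: "\<And>J. ?P J \<Longrightarrow> card J \<le> card I"
    using ex_has_greatest_nat[of ?P "{c}" card "Suc (card T)"] by blast
  have "nbhd I = T"
  proof (rule ccontr)
    assume "nbhd I \<noteq> T"
    moreover have "nbhd I \<noteq> {}"
      using I in_nbhd_singleton unfolding inner_shape_def mem_nbhd
      by (metis card_zigzag card.empty empty_iff equals0I mem_nbhd not_one_le_zero)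
    ultimately obtain x z where x: "x \<in> nbhd I" and z: "z \<in> T - nbhd I" "tri_adj x z"
      using I \<open>connected_cells tri_adj T\<close> by (metis connected_cells_exit)
    have "x \<notin> I" using z by (auto simp: tri_adj_iff_nb nb_in_nbhd)
    then obtain e where e: "nb e x \<in> I" using x by (auto simp: mem_nbhd)
    obtain f where f: "z = nb f x" using z by (auto simp: tri_adj_iff_nb)
    have "f \<noteq> e" using z f e by (auto simp: mem_nbhd)
    have "{e, f} \<subseteq> {e. nb e x \<in> T}" using z e I f by (auto simp: mem_nbhd)
    then have "card {e, f} \<le> card {e. nb e x \<in> T}" by (intro card_mono) auto
    then have "cell_degree tri_adj T x \<noteq> 1" using \<open>f \<noteq> e\<close> by (simp add: cell_degree_tri)
    then have all: "\<forall>e. nb e x \<in> T" "x \<in> T" using deg x I by blast+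
    have x_eq: "nb e (nb e x) = x" by simp
    have sub: "nbhd (insert x I) \<subseteq> T" using I all unfolding nbhd_insert by blast
    then have "inner_shape (insert x I)"
      using inner_shape_extend[of I "nb e x" e T, unfolded x_eq] I e \<open>x \<notin> I\<close>
        \<open>\<not> has_cycle tri_adj T\<close> by blast
    then have "card (insert x I) \<le> card I" using max sub by blast
    moreover have "finite I" using I \<open>finite T\<close> by (metis finite_subset mem_nbhd subset_iff)
    ultimately show False using \<open>x \<notin> I\<close> by simp
  qed
  then show ?thesis using that I by blast
qed


section \<open>Translation classes of full trees of triangles\<close>

lemma tri_shift_shift: "tri_shift (u, v) (tri_shift (u', v') x) = tri_shift (u + u', v + v') x"
  by (cases x) auto

lemma tri_shift_0: "tri_shift (0, 0) x = x"
  by (cases x) auto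

lemma tri_shift_inj [simp]: "tri_shift v x = tri_shift v y \<longleftrightarrow> x = y"
  by (cases v; cases x; cases y) auto

lemma inj_tri_shift: "inj_on (tri_shift v) A"
  by (simp add: inj_on_def)

lemma equiv_tri: "equiv UNIV (translate_rel tri_shift)"
proof (rule equiv_translate_rel[where z = "(0, 0)"])
  show "\<exists>u. \<forall>x. tri_shift v (tri_shift w x) = tri_shift u x" for v w
    by (cases v; cases w) (auto simp: tri_shift_shift)
  show "\<exists>w. \<forall>x. tri_shift w (tri_shift v x) = x" for v
    by (cases v) (rule exI[of _ "(- fst v, - snd v)"], simp add: tri_shift_shift tri_shift_0)
qed (rule tri_shift_0)

lemma up_shift [simp]: "up (tri_shift v x) = up x"
  by (cases v; cases x) auto

lemma nb_shift: "nb e (tri_shift v x) = tri_shift v (nb e x)"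
  by (cases v; cases x; cases e) auto

lemma along_shift: "along d (tri_shift (u, v) x) = along d x + along d (u, v, True)"
  by (cases x; cases d) auto

lemma across_shift: "across d (tri_shift (u, v) x) = across d x + across d (u, v, True)"
  by (cases x; cases d) auto

lemma ex_shift: "\<exists>v. y = tri_shift v x" if "up x = up y"
  using that
  by (cases x; cases y) (auto intro!: exI[of _ "(fst y - fst x, fst (snd y) - fst (snd x))"])

lemma nbhd_shift: "nbhd (tri_shift v ` I) = tri_shift v ` nbhd I"
proof -
  have "(\<exists>e. nb e x \<in> tri_shift v ` I) \<longleftrightarrow> x \<in> tri_shift v ` {x. \<exists>e. nb e x \<in> I}" for x
  proof
    assume "\<exists>e. nb e x \<in> tri_shift v ` I"
    then obtain e y where "nb e x = tri_shift v y" "y \<in> I" by blast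
    then have "x = tri_shift v (nb e y)" by (metis nb_nb nb_shift)
    then show "x \<in> tri_shift v ` {x. \<exists>e. nb e x \<in> I}" using \<open>y \<in> I\<close> nb_nb by (metis (mono_tags, lifting) imageI mem_Collect_eq)
  next
    assume "x \<in> tri_shift v ` {x. \<exists>e. nb e x \<in> I}"
    then obtain y e where "x = tri_shift v y" "nb e y \<in> I" by blast
    then show "\<exists>e. nb e x \<in> tri_shift v ` I" by (metis nb_shift imageI)
  qed
  then show ?thesis unfolding nbhd_def by blast
qed

lemma zigzag_shift:
  "tri_shift (u, v) ` zigzag d h s m =
     zigzag d (h + across d (u, v, True)) (s + along d (u, v, True)) m"
proof (intro equalityI subsetI)
  fix x assume x: "x \<in> zigzag d (h + across d (u, v, True)) (s + along d (u, v, True)) m"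
  have "x = tri_shift (u, v) (tri_shift (- u, - v) x)" by (simp add: tri_shift_shift tri_shift_0)
  moreover from this have "tri_shift (- u, - v) x \<in> zigzag d h s m"
    using x along_shift[of d u v "tri_shift (- u, - v) x"] across_shift[of d u v "tri_shift (- u, - v) x"]
    by (simp add: zigzag_def)
  ultimately show "x \<in> tri_shift (u, v) ` zigzag d h s m" by blast
next
  fix x assume "x \<in> tri_shift (u, v) ` zigzag d h s m"
  then obtain y where "x = tri_shift (u, v) y" "y \<in> zigzag d h s m" by blast
  then show "x \<in> zigzag d (h + across d (u, v, True)) (s + along d (u, v, True)) m"
    by (simp add: zigzag_def along_shift across_shift)
qed

lemma inner_shape_shift:
  assumes "inner_shape I"
  shows "inner_shape (tri_shift v ` I)"
  using assms unfolding inner_shape_def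
proof (elim disjE exE conjE)
  fix d h s m assume "1 \<le> m" "I = zigzag d h s m"
  then show "(\<exists>d h s m. 1 \<le> m \<and> tri_shift v ` I = zigzag d h s m) \<or> (\<exists>c. tri_shift v ` I = nbhd {c})"
    by (cases v) (auto simp: zigzag_shift)
next
  fix c assume "I = nbhd {c}"
  then have "tri_shift v ` I = nbhd {tri_shift v c}" using nbhd_shift[of v "{c}"] by simp
  then show "(\<exists>d h s m. 1 \<le> m \<and> tri_shift v ` I = zigzag d h s m) \<or> (\<exists>c. tri_shift v ` I = nbhd {c})"
    by blast
qed

lemma inner_shape_cells:
  assumes "inner_shape I"
  shows "full_tree tri_adj (nbhd I)" and "card (nbhd I) = 2 * card I + 2"
    and "{x \<in> nbhd I. cell_degree tri_adj (nbhd I) x = 3} = I"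
proof -
  have "full_tree tri_adj (nbhd I) \<and> card (nbhd I) = 2 * card I + 2 \<and>
    {x \<in> nbhd I. cell_degree tri_adj (nbhd I) x = 3} = I"
    using assms unfolding inner_shape_def
  proof (elim disjE exE conjE)
    fix d h s m assume I: "1 \<le> m" "I = zigzag d h s m"
    show ?thesis unfolding I(2) card_zigzag using full_tree_zigzag[OF I(1)] by blast
  next
    fix c assume I: "I = nbhd {c}"
    show ?thesis unfolding I card_nbhd_singleton using full_tree_star[of c] by simp
  qed
  then show "full_tree tri_adj (nbhd I)" "card (nbhd I) = 2 * card I + 2"
    "{x \<in> nbhd I. cell_degree tri_adj (nbhd I) x = 3} = I" by blast+
qed

lemma nbhd_inj: "inner_shape I \<Longrightarrow> inner_shape J \<Longrightarrow> nbhd I = nbhd J \<longleftrightarrow> I = J"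
  using inner_shape_cells(3) by metis

lemma translate_relI: "T = tri_shift v ` S \<Longrightarrow> (S, T) \<in> translate_rel tri_shift"
  by (auto simp: translate_rel_def)

text \<open>
  Taking closed neighbourhoods commutes with translations and is inverted by taking the cells of
  degree 3.
\<close>

lemma card_classes_full_trees:
  assumes "m \<ge> 1"
  shows "card ({I. inner_shape I \<and> card I = m} // translate_rel tri_shift) =
    card ({T. full_tree tri_adj T \<and> card T = 2 * m + 2} // translate_rel tri_shift)"
proof (rule card_quotient_eq[OF equiv_tri equiv_tri])
  show "nbhd I \<in> {T. full_tree tri_adj T \<and> card T = 2 * m + 2}"
    if "I \<in> {I. inner_shape I \<and> card I = m}" for I
    using that inner_shape_cells by simp
  show "(nbhd I, nbhd J) \<in> translate_rel tri_shift \<longleftrightarrow> (I, J) \<in> translate_rel tri_shift"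
    if "I \<in> {I. inner_shape I \<and> card I = m}" "J \<in> {I. inner_shape I \<and> card I = m}" for I J
    using that by (simp add: translate_rel_def nbhd_inj inner_shape_shift flip: nbhd_shift)
  fix T assume "T \<in> {T. full_tree tri_adj T \<and> card T = 2 * m + 2}"
  moreover from this obtain I where I: "inner_shape I" "T = nbhd I"
    using full_tree_eq_nbhd[of T] assms by auto
  ultimately have "card I = m" using inner_shape_cells(2)[OF I(1)] by simp
  then show "\<exists>I\<in>{I. inner_shape I \<and> card I = m}. (nbhd I, T) \<in> translate_rel tri_shift"
    using I equiv_class_self[OF equiv_tri, of T] by (intro bexI[of _ I]) auto
qed

lemma inner_shape_zigzag: "1 \<le> m \<Longrightarrow> inner_shape (zigzag d h s m)"
  unfolding inner_shape_def by blast

lemma inner_shape_star: "inner_shape (nbhd {c})"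
  unfolding inner_shape_def by blast

lemma inner_shape_card_1: "{I. inner_shape I \<and> card I = 1} = range (\<lambda>c. {c})"
proof (intro equalityI subsetI)
  fix I assume "I \<in> range (\<lambda>c :: tri. {c})"
  then obtain c where "I = {c}" by blast
  then show "I \<in> {I. inner_shape I \<and> card I = 1}"
    using inner_shape_zigzag[of 1 S0 "across S0 c" "along S0 c", folded zigzag_1] by simp
next
  fix I :: "tri set" assume "I \<in> {I. inner_shape I \<and> card I = 1}"
  then have "card I = 1" by blast
  then obtain c where "I = {c}" by (rule card_1_singletonE)
  then show "I \<in> range (\<lambda>c. {c})" by blast
qed

definition origin :: "bool \<Rightarrow> tri" where
  "origin u = (0, 0, u)"

lemma up_origin [simp]: "up (origin u) = u"
  by (simp add: origin_def)

lemma shift_of_origin: "\<exists>v. x = tri_shift v (origin (up x))"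
  by (rule ex_shift) simp

lemma card_classes_singletons: "card (range (\<lambda>c. {c}) // translate_rel tri_shift) = 2"
proof -
  have "card (range (\<lambda>c. {c}) // translate_rel tri_shift) = card (UNIV :: bool set)"
  proof (rule card_quotient_representatives[OF equiv_tri, where f = "\<lambda>u. {origin u}"])
    show "i = j" if ij: "({origin i}, {origin j}) \<in> translate_rel tri_shift" for i j
    proof -
      obtain v where "{origin j} = tri_shift v ` {origin i}"
        using ij unfolding translate_rel_def by blast
      then have "origin j = tri_shift v (origin i)" by simp
      then show ?thesis by (metis up_origin up_shift)
    qed
    fix T assume "T \<in> range (\<lambda>c :: tri. {c})"
    then obtain c where "T = {c}" by blast
    moreover obtain v where "c = tri_shift v (origin (up c))" using shift_of_origin by blast
    ultimately have "T = tri_shift v ` {origin (up c)}" by simp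
    then show "\<exists>u\<in>UNIV. ({origin u}, T) \<in> translate_rel tri_shift"
      using translate_relI by blast
  qed auto
  then show ?thesis by simp
qed

definition dominoes :: "tri set set" where
  "dominoes = {{c, nb e c} | c e. True}"

text \<open>
  Represent a pair by its upward triangle and the side at which the other one is attached.
\<close>

lemma card_classes_dominoes: "card (dominoes // translate_rel tri_shift) = 3"
proof -
  have "card (dominoes // translate_rel tri_shift) = card (UNIV :: side set)"
  proof (rule card_quotient_representatives[OF equiv_tri,
      where f = "\<lambda>e. {origin True, nb e (origin True)}"])
    show "i = j" if ij: "({origin True, nb i (origin True)}, {origin True, nb j (origin True)})
      \<in> translate_rel tri_shift" for i j
    proof -
      obtain v where "{origin True, nb j (origin True)} =
          tri_shift v ` {origin True, nb i (origin True)}"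
        using ij unfolding translate_rel_def by blast
      then have v: "{origin True, nb j (origin True)} =
          {tri_shift v (origin True), nb i (tri_shift v (origin True))}"
        by (simp add: nb_shift)
      have "tri_shift v (origin True) \<noteq> nb j (origin True)"
        by (metis up_nb up_origin up_shift)
      then show ?thesis using v by (auto simp: doubleton_eq_iff)
    qed
    fix T assume "T \<in> dominoes"
    then obtain c e where T: "T = {c, nb e c}" by (auto simp: dominoes_def)
    obtain c where c: "up c" "T = {c, nb e c}"
    proof (cases "up c")
      case False
      then show ?thesis using that[of "nb e c"] T by auto
    qed (use T that in auto)
    moreover obtain v where "c = tri_shift v (origin True)" using shift_of_origin[of c] c by auto
    ultimately have "T = tri_shift v ` {origin True, nb e (origin True)}" by (simp add: nb_shift)
    then show "\<exists>e\<in>UNIV. ({origin True, nb e (origin True)}, T) \<in> translate_rel tri_shift"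
      using translate_relI by blast
  qed (auto simp: dominoes_def)
  then show ?thesis by (simp add: UNIV_side)
qed

lemma inner_shape_card_2: "{I. inner_shape I \<and> card I = 2} = dominoes"
proof (intro equalityI subsetI)
  fix I assume "I \<in> dominoes"
  then obtain c e where I: "I = {c, nb e c}" by (auto simp: dominoes_def)
  obtain d where "e \<noteq> d" using third_side[of e e] by metis
  then have "I = zigzag d (across d c) (min (along d c) (along d (nb e c))) 2"
    using I zigzag_2 by simp
  moreover have "card I = 2" using I by simp
  ultimately show "I \<in> {I. inner_shape I \<and> card I = 2}"
    by (simp add: inner_shape_zigzag)
next
  fix I assume "I \<in> {I. inner_shape I \<and> card I = 2}"
  then obtain d h s where I: "I = zigzag d h s 2"
    using card_zigzag card_nbhd_singleton by (auto simp: inner_shape_def)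
  obtain c where c: "along d c = s" "across d c = h" using ex_along_across by blast
  let ?e = "if up c then next_side d else next_side (next_side d)"
  have e: "?e \<noteq> d" "along d (nb ?e c) = s + 1" using c by (cases d; simp add: along_nb)+
  then have "I = {c, nb ?e c}" using zigzag_2[OF e(1), of c] c I by simp
  then show "I \<in> dominoes" unfolding dominoes_def by blast
qed

lemma full_tree_card_2: "{T. full_tree tri_adj T \<and> card T = 2} = dominoes"
proof (intro equalityI subsetI)
  fix T assume "T \<in> dominoes"
  then obtain c e where T: "T = {c, nb e c}" by (auto simp: dominoes_def)
  have "tree_like tri_adj T"
  proof (rule tri.tree_like_by_rank[where f = "\<lambda>x. if x = c then 0 else 1" and r = c])
    show "y = z" if "x \<in> T" "y \<in> T" "z \<in> T" "tri_adj x y" "tri_adj x z" for x y z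
    proof -
      have "y \<noteq> x" "z \<noteq> x" using that tri.irrefl by metis+
      then show ?thesis using that(1-3) T by blast
    qed
    show "\<exists>y\<in>T. tri_adj x y \<and> (if y = c then 0 else 1) < (if x = c then 0 else 1 :: nat)"
      if "x \<in> T" "x \<noteq> c" for x
      using that T by (auto simp: tri_adj_iff_nb intro!: exI[of _ e])
  qed (use T in auto)
  moreover have "{g. nb g x \<in> T} = {e}" if "x \<in> T" for x
  proof -
    have "nb g (nb e c) = c \<longleftrightarrow> g = e" for g by (metis nb_eq_iff nb_nb)
    then have "nb g c \<in> T \<longleftrightarrow> g = e" "nb g (nb e c) \<in> T \<longleftrightarrow> g = e" for g
      by (simp_all add: T)
    moreover have "x = c \<or> x = nb e c" using that by (simp add: T)
    ultimately show ?thesis by blast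
  qed
  ultimately show "T \<in> {T. full_tree tri_adj T \<and> card T = 2}"
    using T by (simp add: full_tree_def cell_degree_tri)
next
  fix T assume "T \<in> {T. full_tree tri_adj T \<and> card T = 2}"
  then have T: "connected_cells tri_adj T" "card T = 2" "finite T"
    by (auto simp: full_tree_def tree_like_def)
  then obtain x where "x \<in> T" by fastforce
  then have "{x} \<subseteq> T" "{x} \<noteq> {}" "{x} \<noteq> T" using T by auto
  then obtain x' y where "x' \<in> {x}" "y \<in> T - {x}" "tri_adj x' y"
    by (rule connected_cells_exit[OF T(1)])
  then have y: "y \<in> T" "y \<noteq> x" "tri_adj x y" by auto
  then have "{x, y} = T" using T \<open>x \<in> T\<close> by (intro card_subset_eq) auto
  then show "T \<in> dominoes" using y unfolding dominoes_def tri_adj_iff_nb by blast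
qed

text \<open>
  The directions of sides crossed inside a set of cells form a translation invariant, which tells
  stars and zigzags of at least three cells in different directions apart.
\<close>

definition inner_sides :: "tri set \<Rightarrow> side set" where
  "inner_sides I = {e. \<exists>x\<in>I. nb e x \<in> I}"

lemma inner_sides_shift: "inner_sides (tri_shift v ` I) = inner_sides I"
  by (simp add: inner_sides_def nb_shift inj_image_mem_iff[OF inj_tri_shift])

lemma inner_sides_zigzag:
  assumes "m \<ge> 3"
  shows "inner_sides (zigzag d h s m) = - {d}"
proof -
  obtain c where c: "along d c = s + 1" "across d c = h" using ex_along_across by blast
  have "c \<in> zigzag d h s m" "nb e c \<in> zigzag d h s m" if "e \<noteq> d" for e
    using c that assms by (simp_all add: zigzag_def along_nb across_nb)
  moreover have "nb d x \<notin> zigzag d h s m" if "x \<in> zigzag d h s m" for x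
    using that by (auto simp: zigzag_def across_nb)
  ultimately show ?thesis unfolding inner_sides_def by blast
qed

lemma inner_sides_star: "inner_sides (nbhd {c}) = UNIV"
  by (auto simp: inner_sides_def in_nbhd_singleton)

lemma zigzag_eqD:
  assumes "zigzag d h s m = zigzag d h' s' m" "m \<ge> 1"
  shows "h = h' \<and> s = s'"
proof -
  have *: "h = h' \<and> s' \<le> s" if "zigzag d h s m = zigzag d h' s' m" for h h' s s'
  proof -
    obtain c where c: "along d c = s" "across d c = h" using ex_along_across by blast
    then have "c \<in> zigzag d h s m" using assms(2) by (simp add: zigzag_def)
    then have "c \<in> zigzag d h' s' m" using that by simp
    then show ?thesis using c by (simp add: zigzag_def)
  qed
  show ?thesis using *[OF assms(1)] *[OF assms(1)[symmetric]] by simp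
qed

lemma star_eqD:
  assumes "nbhd {c} = nbhd {c'}"
  shows "c = c'"
proof -
  have "inner_shape {x}" for x using inner_shape_card_1 by blast
  then show ?thesis using nbhd_inj assms by (metis singleton_inject)
qed

text \<open>
  Translations change \<open>along d + across d\<close> by arbitrary even amounts, so a zigzag can be moved to row 0
  such that it starts at position 0 (with an upward triangle) or 1 (with a downward one). The last component
  is the orientation of the centre of a star.
\<close>

fun representative :: "nat \<Rightarrow> side \<times> bool + bool \<Rightarrow> tri set" where
  "representative m (Inl (d, u)) = zigzag d 0 (if u then 0 else 1) m"
| "representative m (Inr u) = nbhd {origin u}"

lemma card_classes_inner_shapes:
  assumes "m \<ge> 3"
  shows "card ({I. inner_shape I \<and> card I = m} // translate_rel tri_shift) = (if m = 4 then 8 else 6)"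
proof -
  let ?Rs = "range Inl \<union> (if m = 4 then range Inr else {}) :: (side \<times> bool + bool) set"
  have "card ({I. inner_shape I \<and> card I = m} // translate_rel tri_shift) = card ?Rs"
  proof (rule card_quotient_representatives[OF equiv_tri, where f = "representative m"])
    show "representative m i \<in> {I. inner_shape I \<and> card I = m}" if "i \<in> ?Rs" for i
      using that assms card_zigzag card_nbhd_singleton
      by (cases "(m, i)" rule: representative.cases) (auto simp: inner_shape_zigzag inner_shape_star split: if_splits)
  next
    fix i j assume "(representative m i, representative m j) \<in> translate_rel tri_shift"
    then obtain p q where v: "representative m j = tri_shift (p, q) ` representative m i"
      by (auto simp: translate_rel_def)
    then have sides: "inner_sides (representative m j) = inner_sides (representative m i)"
      by (simp add: inner_sides_shift)
    show "i = j"
    proof (cases i)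
      case i: (Inl du)
      obtain d u where du: "du = (d, u)" by fastforce
      show ?thesis
      proof (cases j)
        case j: (Inl du')
        obtain d' u' where du': "du' = (d', u')" by fastforce
        have d: "d' = d"
          using sides assms i j du du' by (simp add: inner_sides_zigzag)
        then have "across d (p, q, True) = 0"
          and s: "(if u' then 0 else 1) = (if u then 0 else 1) + along d (p, q, True)"
          using v zigzag_eqD[of d 0 "if u' then 0 else 1" m "across d (p, q, True)"] assms i j du du'
          by (simp_all add: zigzag_shift)
        then have "even (along d (p, q, True))" using up_iff_even[of "(p, q, True)" d] by simp
        then have "u = u'" using s by (cases u; cases u'; simp; presburger)
        then show ?thesis using d i j du du' by simp
      next
        case j: (Inr u')
        then have "UNIV = - {d}" using sides assms i du
          by (simp add: inner_sides_zigzag inner_sides_star)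
        then show ?thesis by blast
      qed
    next
      case i: (Inr u)
      show ?thesis
      proof (cases j)
        case j: (Inl du')
        then show ?thesis using sides assms i
          by (cases du') (auto simp: inner_sides_zigzag inner_sides_star)
      next
        case j: (Inr u')
        then have "nbhd {origin u'} = nbhd {tri_shift (p, q) (origin u)}"
          using v i nbhd_shift[of "(p, q)" "{origin u}"] by simp
        then have "origin u' = tri_shift (p, q) (origin u)" by (rule star_eqD)
        then have "u' = u" by (metis up_origin up_shift)
        then show ?thesis using i j by simp
      qed
    qed
  next
    fix I assume I: "I \<in> {I. inner_shape I \<and> card I = m}"
    then consider d h s where "I = zigzag d h s m" | c where "m = 4" "I = nbhd {c}"
      using card_zigzag card_nbhd_singleton by (auto simp: inner_shape_def)
    then show "\<exists>i\<in>?Rs. (representative m i, I) \<in> translate_rel tri_shift"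
    proof cases
      case (1 d h s)
      \<comment> \<open>the parity of \<open>along d + across d\<close> determines the new start in row 0\<close>
      let ?s = "if even (s + h) then 0 else 1 :: int"
      obtain x where x: "along d x = s - ?s" "across d x = h" using ex_along_across by blast
      have "up x" using x up_iff_even[of x d] by auto
      then obtain p q where "x = (p, q, True)" by (cases x) auto
      then have "I = tri_shift (p, q) ` zigzag d 0 ?s m"
        using x 1 by (simp add: zigzag_shift)
      then have "I = tri_shift (p, q) ` representative m (Inl (d, even (s + h)))" by simp
      then show ?thesis using translate_relI by blast
    next
      case (2 c)
      obtain v where "c = tri_shift v (origin (up c))" using shift_of_origin by blast
      then have "I = tri_shift v ` representative m (Inr (up c))"
        using 2(2) nbhd_shift[of v "{origin (up c)}"] by simp
      moreover have "Inr (up c) \<in> ?Rs" using 2(1) by simp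
      ultimately show ?thesis using translate_relI by blast
    qed
  qed
  also have "card ?Rs = (if m = 4 then 8 else 6)"
  proof -
    have "card (range Inl :: (side \<times> bool + bool) set) = 6"
      by (simp add: card_image UNIV_side flip: UNIV_Times_UNIV)
    moreover have "card (range Inr :: (side \<times> bool + bool) set) = 2"
      by (simp add: card_image)
    moreover have "(range Inl :: (side \<times> bool + bool) set) \<inter> range Inr = {}" by auto
    ultimately show ?thesis by (simp add: card_Un_disjoint)
  qed
  finally show ?thesis .
qed

lemma stri_t_even:
  assumes "k > 0"
  shows "stri_t (2 * k) =
    (if k = 1 \<or> k = 3 then 3 else if k = 2 then 2 else if k = 5 then 8 else 6)"
proof (cases "k = 1")
  case True
  then show ?thesis
    using full_tree_card_2 card_classes_dominoes
    by (simp add: stri_t_def tri.saturated_iff_full_tree)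
next
  case False
  then obtain m where m: "k = Suc m" "m \<ge> 1" using assms by (cases k) auto
  then have "stri_t (2 * k) = card ({I. inner_shape I \<and> card I = m} // translate_rel tri_shift)"
    using card_classes_full_trees[of m] by (simp add: stri_t_def tri.saturated_iff_full_tree)
  also have "\<dots> = (if m = 2 then 3 else if m = 1 then 2 else if m = 4 then 8 else 6)"
    using card_classes_inner_shapes[of m] m(2) inner_shape_card_1 inner_shape_card_2
      card_classes_singletons card_classes_dominoes
    by (cases "m = 1"; cases "m = 2") auto
  finally show ?thesis using m by auto
qed


section \<open>Full trees of hexagons\<close>

interpretation hex: cell_graph hex_adj
proof
  show "hex_adj y x" if "hex_adj x y" for x y
    using that unfolding hex_adj_def by blast
qed (simp add: hex_adj_def)

text \<open>
  The neighbours are listed in counterclockwise order, such that consecutive ones are adjacent.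
\<close>

fun hex_nbs :: "hex \<Rightarrow> hex list" where
  "hex_nbs (a, b) = [(a + 1, b), (a, b + 1), (a - 1, b + 1), (a - 1, b), (a, b - 1), (a + 1, b - 1)]"

fun colour :: "hex \<Rightarrow> int" where
  "colour (a, b) = (a - b) mod 3"

lemma hex_adj_iff_hex_nbs: "hex_adj c d \<longleftrightarrow> d \<in> set (hex_nbs c)"
proof -
  obtain a b where c: "c = (a, b)" by fastforce
  obtain p q where d: "d = (p, q)" by fastforce
  have "(p - a, q - b) = (i, j) \<longleftrightarrow> (p, q) = (a + i, b + j)" for i j
    by auto
  then show ?thesis
    unfolding c d hex_adj_iff hex_nbs.simps list.set insert_iff empty_iff by (simp only:) simp
qed

lemma consecutive_hex_nbs_adj: "hex_adj (hex_nbs c ! i) (hex_nbs c ! ((i + 1) mod 6))" if "i < 6"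
proof -
  have "i = 0 \<or> i = 1 \<or> i = 2 \<or> i = 3 \<or> i = 4 \<or> i = 5" using that by arith
  then show ?thesis by (cases c) (auto simp: hex_adj_iff)
qed

lemma no_two_consecutive_hex_nbs:
  assumes "tree_like hex_adj T" "c \<in> T" "hex_nbs c = [n0, n1, n2, n3, n4, n5]"
  shows "\<not> (n0 \<in> T \<and> n1 \<in> T)" "\<not> (n1 \<in> T \<and> n2 \<in> T)" "\<not> (n2 \<in> T \<and> n3 \<in> T)"
    "\<not> (n3 \<in> T \<and> n4 \<in> T)" "\<not> (n4 \<in> T \<and> n5 \<in> T)" "\<not> (n5 \<in> T \<and> n0 \<in> T)"
proof -
  have *: "\<not> (x \<in> T \<and> y \<in> T)" if "hex_adj x y" "x \<in> set (hex_nbs c)" "y \<in> set (hex_nbs c)" for x y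
    using hex.no_triangle[OF assms(1), of x c y] that assms(2) hex.sym
    unfolding hex_adj_iff_hex_nbs[symmetric] by blast
  show "\<not> (n0 \<in> T \<and> n1 \<in> T)" "\<not> (n1 \<in> T \<and> n2 \<in> T)" "\<not> (n2 \<in> T \<and> n3 \<in> T)"
    "\<not> (n3 \<in> T \<and> n4 \<in> T)" "\<not> (n4 \<in> T \<and> n5 \<in> T)" "\<not> (n5 \<in> T \<and> n0 \<in> T)"
    using consecutive_hex_nbs_adj[of 0 c] consecutive_hex_nbs_adj[of 1 c] consecutive_hex_nbs_adj[of 2 c] consecutive_hex_nbs_adj[of 3 c]
      consecutive_hex_nbs_adj[of 4 c] consecutive_hex_nbs_adj[of 5 c] unfolding assms(3)
    by (intro *; simp add: assms(3))+
qed

lemma hex_nbs_eq: "\<exists>n0 n1 n2 n3 n4 n5. hex_nbs c = [n0, n1, n2, n3, n4, n5]"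
  by (cases c) simp

interpretation hex: cubic_cell_graph hex_adj
proof
  fix T c assume T: "tree_like hex_adj T" "c \<in> T"
  obtain n0 n1 n2 n3 n4 n5 where nbs: "hex_nbs c = [n0, n1, n2, n3, n4, n5]" using hex_nbs_eq by blast
  \<comment> \<open>each of three pairs of consecutive neighbours contributes at most one cell\<close>
  let ?S = "{if n0 \<in> T then n0 else n1, if n2 \<in> T then n2 else n3, if n4 \<in> T then n4 else n5}"
  have "{d \<in> T. hex_adj c d} \<subseteq> ?S"
    using no_two_consecutive_hex_nbs[OF T nbs] by (auto simp: hex_adj_iff_hex_nbs nbs)
  then have "cell_degree hex_adj T c \<le> card ?S"
    unfolding cell_degree_def by (intro card_mono) auto
  also have "\<dots> \<le> 3" by (auto simp: card_insert_if)
  finally show "cell_degree hex_adj T c \<le> 3" .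
qed

lemma colour_hex_nbs:
  assumes "hex_nbs c = [n0, n1, n2, n3, n4, n5]"
  shows "colour n0 = colour n2" "colour n2 = colour n4" "colour n1 = colour n3" "colour n3 = colour n5"
    "colour n0 \<noteq> colour c" "colour n1 \<noteq> colour c"
proof -
  obtain a b where c: "c = (a, b)" by fastforce
  have n: "n0 = (a + 1, b)" "n1 = (a, b + 1)" "n2 = (a - 1, b + 1)"
    "n3 = (a - 1, b)" "n4 = (a, b - 1)" "n5 = (a + 1, b - 1)"
    using assms by (simp_all add: c)
  show "colour n0 = colour n2" "colour n2 = colour n4" "colour n1 = colour n3" "colour n3 = colour n5"
    "colour n0 \<noteq> colour c" "colour n1 \<noteq> colour c"
    unfolding n c colour.simps mod_eq_dvd_iff by (simp_all add: algebra_simps)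
qed

text \<open>
  The colours alternate around a cell. Two neighbours in the tree of different colours are not
  consecutive, so they are opposite, and then each of the other four neighbours is consecutive to one
  of them.
\<close>

lemma degree_2_if_colours_differ:
  assumes "tree_like hex_adj T" "x \<in> T" "y \<in> T" "z \<in> T" "hex_adj x y" "hex_adj x z"
    and "colour y \<noteq> colour z"
  shows "cell_degree hex_adj T x = 2"
proof -
  obtain n0 n1 n2 n3 n4 n5 where nbs: "hex_nbs x = [n0, n1, n2, n3, n4, n5]" using hex_nbs_eq by blast
  have "{d \<in> T. hex_adj x d} = {y, z}"
    using no_two_consecutive_hex_nbs[OF assms(1,2) nbs] colour_hex_nbs[OF nbs] assms
    unfolding hex_adj_iff_hex_nbs nbs list.set by (elim insertE emptyE) (simp; blast)+
  moreover have "y \<noteq> z" using assms by auto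
  ultimately show ?thesis by (simp add: cell_degree_def)
qed

text \<open>
  Along a path from \<open>x0\<close>, every cell has a neighbour in the tree that avoids the third colour; as its
  degree is not 2, all its neighbours in the tree have the colour of that neighbour.
\<close>

lemma two_colours_suffice:
  assumes full: "full_tree hex_adj T" and "x0 \<in> T" "y0 \<in> T" "hex_adj x0 y0"
    and "colour x0 \<noteq> 2" "colour y0 \<noteq> 2" "x \<in> T"
  shows "colour x \<noteq> 2"
proof -
  have tree: "tree_like hex_adj T" using full by (simp add: full_tree_def)
  then have "(\<lambda>x y. x \<in> T \<and> y \<in> T \<and> hex_adj x y)\<^sup>*\<^sup>* x0 x"
    using assms by (auto simp: tree_like_def connected_cells_def)
  then have "colour x \<noteq> 2 \<and> (\<exists>y\<in>T. hex_adj x y \<and> colour y \<noteq> 2)"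
  proof induction
    case base
    then show ?case using assms by blast
  next
    case (step x z)
    then obtain y where y: "y \<in> T" "hex_adj x y" "colour y \<noteq> 2" by blast
    have "cell_degree hex_adj T x \<noteq> 2" using full step by (auto simp: full_tree_def)
    then have "colour y = colour z"
      using degree_2_if_colours_differ[OF tree, of x y z] step y by blast
    then show ?case using y step hex.sym by metis
  qed
  then show ?thesis by blast
qed

text \<open>
  Upward triangles go to hexagons of colour 0 and downward ones to hexagons of colour 1. The
  hexagons of colour 2 are those that are left out.
\<close>

fun embed :: "tri \<Rightarrow> hex" where
  "embed (a, b, u) = (2 * a + b + (if u then 0 else 1), b - a)"

lemma colour_embed: "colour (embed x) = (if up x then 0 else 1)"
  by (cases x) (simp; presburger)

lemma inj_embed: "inj embed"
proof (rule injI)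
  fix x y assume eq: "embed x = embed y"
  then have "up x = up y" using colour_embed[of x] colour_embed[of y] by (auto split: if_splits)
  then show "x = y" using eq by (cases x; cases y) auto
qed

lemma hex_nbs_embed:
  obtains m0 m1 m2 where "set (hex_nbs (embed x)) = {embed (nb S0 x), embed (nb S1 x), embed (nb S2 x), m0, m1, m2}"
    and "colour m0 = 2" "colour m1 = 2" "colour m2 = 2"
proof -
  obtain a b u where x: "x = (a, b, u)" by (cases x)
  show ?thesis
  proof (cases u)
    case True
    let ?p = "2 * a + b" and ?q = "b - a"
    have eq: "set (hex_nbs (embed x)) = {embed (nb S0 x), embed (nb S1 x), embed (nb S2 x),
        (?p, ?q + 1), (?p - 1, ?q), (?p + 1, ?q - 1)}"
      using True by (auto simp: x)
    have "?p - (?q + 1) = 2 + 3 * (a - 1)" "?p - 1 - ?q = 2 + 3 * (a - 1)"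
      "?p + 1 - (?q - 1) = 2 + 3 * a" by simp_all
    then have "colour (?p, ?q + 1) = 2" "colour (?p - 1, ?q) = 2" "colour (?p + 1, ?q - 1) = 2"
      unfolding colour.simps by (simp_all only: mod_mult_self2) simp_all
    then show ?thesis using that[OF eq] by blast
  next
    case False
    let ?p = "2 * a + b + 1" and ?q = "b - a"
    have eq: "set (hex_nbs (embed x)) = {embed (nb S0 x), embed (nb S1 x), embed (nb S2 x),
        (?p + 1, ?q), (?p - 1, ?q + 1), (?p, ?q - 1)}"
      using False by (auto simp: x)
    have "?p + 1 - ?q = 2 + 3 * a" "?p - 1 - (?q + 1) = 2 + 3 * (a - 1)"
      "?p - (?q - 1) = 2 + 3 * a" by simp_all
    then have "colour (?p + 1, ?q) = 2" "colour (?p - 1, ?q + 1) = 2" "colour (?p, ?q - 1) = 2"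
      unfolding colour.simps by (simp_all only: mod_mult_self2) simp_all
    then show ?thesis using that[OF eq] by blast
  qed
qed

lemma hex_adj_embed: "hex_adj (embed x) (embed y) \<longleftrightarrow> tri_adj x y"
proof -
  obtain m0 m1 m2 where m: "set (hex_nbs (embed x)) =
      {embed (nb S0 x), embed (nb S1 x), embed (nb S2 x), m0, m1, m2}"
    "colour m0 = 2" "colour m1 = 2" "colour m2 = 2"
    by (rule hex_nbs_embed)
  have "embed y \<noteq> m0" "embed y \<noteq> m1" "embed y \<noteq> m2"
    using m(2-4) colour_embed[of y] by (auto split: if_splits)
  then have "hex_adj (embed x) (embed y) \<longleftrightarrow> y = nb S0 x \<or> y = nb S1 x \<or> y = nb S2 x"
    unfolding hex_adj_iff_hex_nbs m(1) by (simp add: inj_eq[OF inj_embed])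
  also have "\<dots> \<longleftrightarrow> tri_adj x y"
    unfolding tri_adj_iff_nb by (metis side.exhaust)
  finally show ?thesis .
qed

lemma range_embed: "range embed = {c. colour c \<noteq> 2}"
proof (intro equalityI subsetI)
  fix c assume c: "c \<in> {c. colour c \<noteq> 2}"
  obtain p q where pq: "c = (p, q)" by fastforce
  let ?a = "(p - q) div 3"
  have "(p - q) mod 3 = 0 \<or> (p - q) mod 3 = 1" using c pq by simp presburger
  then have "c = embed (?a, q + ?a, (p - q) mod 3 = 0)"
    unfolding pq embed.simps prod.inject by (elim disjE; simp; presburger)
  then show "c \<in> range embed" by blast
next
  fix c assume "c \<in> range embed"
  then obtain x where "c = embed x" by blast
  then show "c \<in> {c. colour c \<noteq> 2}" by (simp add: colour_embed)
qed

lemma hex_shift_shift: "hex_shift (u, v) (hex_shift (u', v') x) = hex_shift (u + u', v + v') x"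
  by (cases x) auto

lemma hex_shift_0: "hex_shift (0, 0) x = x"
  by (cases x) auto

lemma equiv_hex: "equiv UNIV (translate_rel hex_shift)"
proof (rule equiv_translate_rel[where z = "(0, 0)"])
  show "\<exists>u. \<forall>x. hex_shift v (hex_shift w x) = hex_shift u x" for v w
    by (cases v; cases w) (metis hex_shift_shift)
  show "\<exists>w. \<forall>x. hex_shift w (hex_shift v x) = x" for v
    by (cases v) (rule exI[of _ "(- fst v, - snd v)"], simp add: hex_shift_shift hex_shift_0)
qed (rule hex_shift_0)

lemma inj_hex_shift: "inj_on (hex_shift v) A"
  by (cases v) (auto simp: inj_on_def)

lemma hex_adj_shift: "hex_adj (hex_shift v x) (hex_shift v y) = hex_adj x y"
  by (cases v; cases x; cases y) (simp add: hex_adj_iff)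

lemma embed_shift: "embed (tri_shift (u, v) x) = hex_shift (2 * u + v, v - u) (embed x)"
  by (cases x) auto

lemma colour_shift: "colour (hex_shift (p, q) c) = (colour c + (p - q)) mod 3"
proof -
  obtain a b where c: "c = (a, b)" by fastforce
  have "a + p - (b + q) = a - b + (p - q)" by simp
  then show ?thesis unfolding c hex_shift.simps colour.simps by (simp only: mod_add_left_eq)
qed

lemma full_tree_embed: "full_tree hex_adj (embed ` T) \<longleftrightarrow> full_tree tri_adj T"
  using inj_embed by (intro full_tree_image_iff) (auto simp: hex_adj_embed intro: inj_on_subset)

lemma full_tree_hex_shift: "full_tree hex_adj (hex_shift v ` T) \<longleftrightarrow> full_tree hex_adj T"
  by (intro full_tree_image_iff inj_hex_shift) (simp add: hex_adj_shift)

text \<open>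
  Two adjacent cells use at most two colours. A translation makes 2 the remaining colour, and then
  \<open>two_colours_suffice\<close> moves the whole tree into the range of \<open>embed\<close>.
\<close>

lemma hex_full_tree_is_embedded:
  assumes "full_tree hex_adj T"
  obtains U v where "full_tree tri_adj U" "T = hex_shift v ` embed ` U" "card U = card T"
proof -
  obtain x y where xy: "x \<in> T" "y \<in> T" "hex_adj x y"
    using assms by (rule hex.full_tree_adjacent_pair)
  have col: "colour c = 0 \<or> colour c = 1 \<or> colour c = 2" for c
    by (cases c) (simp; presburger)
  have "\<exists>t. (colour x + t) mod 3 \<noteq> 2 \<and> (colour y + t) mod 3 \<noteq> 2"
    using col[of x] col[of y]
    by (elim disjE; simp only:) (rule exI[of _ 0] exI[of _ 1] exI[of _ 2]; simp; fail)+
  then obtain t where t: "(colour x + t) mod 3 \<noteq> 2" "(colour y + t) mod 3 \<noteq> 2" by blast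
  let ?T = "hex_shift (t, 0) ` T"
  have full: "full_tree hex_adj ?T" using assms by (simp add: full_tree_hex_shift)
  have "?T \<subseteq> range embed"
    using two_colours_suffice[OF full, of "hex_shift (t, 0) x" "hex_shift (t, 0) y"] xy t
    by (auto simp: range_embed colour_shift hex_adj_shift)
  then obtain U where U: "?T = embed ` U" by (auto simp: subset_image_iff)
  have "hex_shift (- t, 0) ` ?T = T" by (simp add: image_image hex_shift_shift hex_shift_0)
  then have "T = hex_shift (- t, 0) ` embed ` U" by (simp add: U)
  moreover from this have "card U = card T"
    using inj_embed by (simp add: card_image inj_hex_shift inj_on_subset)
  moreover have "full_tree tri_adj U" using full by (simp add: U full_tree_embed)
  ultimately show ?thesis using that by blast
qed

text \<open>
  A full tree contains triangles of both orientations, so its image uses both colours 0 and 1. A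
  translation that avoids colour 2 again must preserve colours, and such translations come from the
  triangular lattice.
\<close>

lemma translate_rel_embed:
  assumes "full_tree tri_adj U"
  shows "(embed ` U, embed ` U') \<in> translate_rel hex_shift \<longleftrightarrow> (U, U') \<in> translate_rel tri_shift"
proof
  assume "(U, U') \<in> translate_rel tri_shift"
  then obtain v where v: "U' = tri_shift v ` U" unfolding translate_rel_def by blast
  obtain p q where "v = (p, q)" by fastforce
  then have "embed ` U' = hex_shift (2 * p + q, q - p) ` embed ` U"
    using v by (simp add: image_image embed_shift)
  then show "(embed ` U, embed ` U') \<in> translate_rel hex_shift"
    unfolding translate_rel_def by blast
next
  assume "(embed ` U, embed ` U') \<in> translate_rel hex_shift"
  then obtain v where v: "embed ` U' = hex_shift v ` embed ` U" unfolding translate_rel_def by blast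
  obtain p q where pq: "v = (p, q)" by fastforce
  have colour: "(colour (embed x) + (p - q)) mod 3 \<noteq> 2" if "x \<in> U" for x
  proof -
    have "hex_shift v (embed x) \<in> embed ` U'" using v that by blast
    then have "colour (hex_shift v (embed x)) \<noteq> 2" using range_embed by blast
    then show ?thesis by (simp add: pq colour_shift)
  qed
  obtain x y where "x \<in> U" "y \<in> U" "tri_adj x y"
    using assms by (rule tri.full_tree_adjacent_pair)
  moreover from this have "up x \<noteq> up y" by (auto simp: tri_adj_iff_nb)
  ultimately have "(0 + (p - q)) mod 3 \<noteq> 2" "(1 + (p - q)) mod 3 \<noteq> 2"
    using colour[of x] colour[of y] by (auto simp: colour_embed split: if_splits)
  then have "(p - q) mod 3 = 0" by presburger
  then obtain a where a: "p - q = 3 * a" by (auto simp: mod_eq_0_iff_dvd dvd_def)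
  have "hex_shift v (embed x) = embed (tri_shift (a, q + a) x)" for x
    unfolding embed_shift pq using a by (intro arg_cong2[where f = hex_shift]) auto
  then have "embed ` U' = embed ` tri_shift (a, q + a) ` U"
    unfolding v image_image by simp
  then have "U' = tri_shift (a, q + a) ` U" using inj_embed by (simp add: inj_image_eq_iff)
  then show "(U, U') \<in> translate_rel tri_shift" unfolding translate_rel_def by blast
qed

lemma shex_t_eq_stri_t: "shex_t (2 * k) = stri_t (2 * k)"
proof -
  let ?A = "{T. full_tree tri_adj T \<and> card T = 2 * k}"
  let ?B = "{T. full_tree hex_adj T \<and> card T = 2 * k}"
  have "card (?A // translate_rel tri_shift) = card (?B // translate_rel hex_shift)"
  proof (rule card_quotient_eq[OF equiv_tri equiv_hex, where F = "image embed"])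
    show "embed ` U \<in> ?B" if "U \<in> ?A" for U
      using that by (simp add: full_tree_embed card_image inj_on_subset[OF inj_embed])
    show "(embed ` U, embed ` U') \<in> translate_rel hex_shift \<longleftrightarrow> (U, U') \<in> translate_rel tri_shift"
      if "U \<in> ?A" for U U'
      using that by (simp add: translate_rel_embed)
    fix T assume T: "T \<in> ?B"
    then obtain U v where "full_tree tri_adj U" "T = hex_shift v ` embed ` U" "card U = card T"
      using hex_full_tree_is_embedded by blast
    then show "\<exists>U\<in>?A. (embed ` U, T) \<in> translate_rel hex_shift"
      using T unfolding translate_rel_def by auto
  qed
  then show ?thesis
    by (simp add: shex_t_def stri_t_def hex.saturated_iff_full_tree tri.saturated_iff_full_tree)
qed

theorem proposition6p9:
  fixes k :: nat
  assumes "k > 0"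
  shows "shex_t (2 * k) = stri_t (2 * k) \<and>
    stri_t (2 * k) =
      (if k = 1 \<or> k = 3 then 3
       else if k = 2 then 2
       else if k = 5 then 8
       else 6)"
  using shex_t_eq_stri_t stri_t_even[OF assms] by blast

end
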